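(* Let $d\ge 0$ and $r\ge d+1$ be integers. Let $X$ be a $d$-Leray simplicial complex on vertex set $V=V_1\sqcup\cdots\sqcup V_r$ such that $V_1*\cdots*V_r\subseteq X$, i.e. every subset of $V$ containing at most one element of each $V_i$ is a face of $X$. Then $$\sum_{i=1}^r\delta_X(V_i)\ \ge\ 0 .$$
   Context: A simplicial complex $K$ is a finite nonempty family of finite sets (faces) closed under taking subsets (so $\varnothing\in K$); its vertex set $V(K)$ is the union of its faces. For $W\subseteq V(K)$, $K[W]=\{\sigma\in K:\sigma\subseteq W\}$. For $\tau\in K$, the link is $\operatorname{lk}(K,\tau)=\{\sigma\in K:\sigma\cap\tau=\varnothing,\ \sigma\cup\tau\in K\}$. $\widetilde H_i(K)$, $i\ge -1$, is reduced simplicial homology over $\mathbb Z$, with $\widetilde H_{-1}(\{\varnothing\})\cong\mathbb Z$ and $\widetilde H_{-1}(K)=0$ if $K$ has a vertex. The Leray number is $$L(K)=\min\{j\ge 0:\widetilde H_i(K[W])=0\text{ for all }W\subseteq V(K)\text{ and all }i\ge j\},$$ and $K$ is $d$-Leray if $L(K)\le d$. The *link-Leray dimension* of a set $W\subseteq V(K)$ is $\delta_K(W)=L(\operatorname{lk}(K,W))$ if $W\in K$, and $\delta_K(W)=-1$ otherwise. *)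

theory Defs
  imports "HOL-Algebra.Free_Abelian_Groups" "HOL-Library.Disjoint_Sets"
begin

definition simplicial_complex :: "'a set set \<Rightarrow> bool" where
  "simplicial_complex K \<longleftrightarrow>
     finite K \<and> K \<noteq> {} \<and> (\<forall>\<sigma>\<in>K. finite \<sigma>) \<and> (\<forall>\<sigma>\<in>K. \<forall>\<tau>. \<tau> \<subseteq> \<sigma> \<longrightarrow> \<tau> \<in> K)"

definition vertices :: "'a set set \<Rightarrow> 'a set" where
  "vertices K = \<Union>K"

definition induced_subcomplex :: "'a set set \<Rightarrow> 'a set \<Rightarrow> 'a set set" where
  "induced_subcomplex K W = {\<sigma> \<in> K. \<sigma> \<subseteq> W}"

definition link :: "'a set set \<Rightarrow> 'a set \<Rightarrow> 'a set set" where
  "link K \<tau> = {\<sigma> \<in> K. \<sigma> \<inter> \<tau> = {} \<and> \<sigma> \<union> \<tau> \<in> K}"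

(* Orienting the simplices requires a total order of the vertices. One (reflexive) order
   of the whole type is chosen once and for all, so that the vertex type can stay arbitrary;
   up to isomorphism, homology does not depend on it. *)
definition vertex_order :: "'a rel" where
  "vertex_order = (SOME r. linear_order r)"

lemma linear_order_vertex_order: "linear_order (vertex_order :: 'a rel)"
proof -
  obtain r :: "'a rel" where "well_order_on UNIV r"
    using well_order_on by blast
  then have "linear_order r"
    by (simp add: well_order_on_def)
  then show ?thesis
    unfolding vertex_order_def by (rule someI)
qed

(* The empty face has dimension -1; hence the chain complex below is the augmented one. *)
definition faces :: "'a set set \<Rightarrow> int \<Rightarrow> 'a set set" where
  "faces K i = {\<sigma> \<in> K. int (card \<sigma>) = i + 1}"

definition simplicial_chain_group :: "'a set set \<Rightarrow> int \<Rightarrow> ('a set \<Rightarrow>\<^sub>0 int) monoid" where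
  "simplicial_chain_group K i = free_Abelian_group (faces K i)"

(* The position of the vertex x in the face, counted from 0. *)
definition vertex_position :: "'a set \<Rightarrow> 'a \<Rightarrow> nat" where
  "vertex_position \<sigma> x = card {y \<in> \<sigma>. (y, x) \<in> vertex_order \<and> y \<noteq> x}"

definition simplex_boundary :: "'a set \<Rightarrow> ('a set \<Rightarrow>\<^sub>0 int)" where
  "simplex_boundary \<sigma> =
     (\<Sum>x\<in>\<sigma>. frag_cmul ((-1) ^ vertex_position \<sigma> x) (frag_of (\<sigma> - {x})))"

definition boundary_map :: "('a set \<Rightarrow>\<^sub>0 int) \<Rightarrow> ('a set \<Rightarrow>\<^sub>0 int)" where
  "boundary_map = frag_extend simplex_boundary"

definition simplicial_cycles :: "'a set set \<Rightarrow> int \<Rightarrow> ('a set \<Rightarrow>\<^sub>0 int) set" where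
  "simplicial_cycles K i = {c \<in> carrier (simplicial_chain_group K i). boundary_map c = 0}"

definition simplicial_boundaries :: "'a set set \<Rightarrow> int \<Rightarrow> ('a set \<Rightarrow>\<^sub>0 int) set" where
  "simplicial_boundaries K i = boundary_map ` carrier (simplicial_chain_group K (i + 1))"

definition reduced_simplicial_homology_group ::
    "'a set set \<Rightarrow> int \<Rightarrow> ('a set \<Rightarrow>\<^sub>0 int) set monoid" where
  "reduced_simplicial_homology_group K i =
     subgroup_generated (simplicial_chain_group K i) (simplicial_cycles K i)
       Mod simplicial_boundaries K i"

definition Leray_number :: "'a set set \<Rightarrow> nat" where
  "Leray_number K =
     (LEAST j. \<forall>W\<subseteq>vertices K. \<forall>i\<ge>int j.
        trivial_group (reduced_simplicial_homology_group (induced_subcomplex K W) i))"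

definition Leray :: "nat \<Rightarrow> 'a set set \<Rightarrow> bool" where
  "Leray d K \<longleftrightarrow> Leray_number K \<le> d"

definition link_Leray_dimension :: "'a set set \<Rightarrow> 'a set \<Rightarrow> int" where
  "link_Leray_dimension K W = (if W \<in> K then int (Leray_number (link K W)) else -1)"

end

theory Submission
  imports Defs
begin

text \<open>
  Call a set of vertices admissible if it contains at least two vertices of every colour. If each
  colour class of \<open>A\<close> has exactly two vertices, applying the boundary operators of all \<open>r\<close> colours
  to \<open>A\<close> gives a cycle of transversals, which lies in \<open>X\<close>. Since \<open>X\<close> is acyclic from dimension \<open>r - 1\<close>
  on, these cycles can be filled compatibly: there are chains \<open>\<phi>(A)\<close> of dimension \<open>|A| - r\<close> in the
  subcomplex induced on \<open>A\<close>, with boundary \<open>\<phi>(\<partial>A)\<close> plus the transversal cycle of \<open>A\<close>.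

  Such a \<open>\<phi>\<close> passes from \<open>r\<close> to \<open>r - 1\<close> colours. Order the vertices of a colour class \<open>W\<close> as
  \<open>v\<^sub>1, \<dots>, v\<^sub>n\<close>. The parts of \<open>\<phi>({v\<^sub>1, \<dots>, v\<^sub>k\<^sub>+\<^sub>1} \<union> A)\<close> that meet \<open>W\<close> exactly in \<open>v\<^sub>1, \<dots>, v\<^sub>k\<close>
  are successive homotopies; they telescope to a filler for the remaining colours, up to the chain map
  \<open>A \<mapsto> \<close> part of \<open>\<phi>(W \<union> A)\<close> containing \<open>W\<close>. That map takes values in the link of \<open>W\<close>, so it vanishes if
  \<open>W\<close> is not a face, and is null-homotopic if the link of \<open>W\<close> is \<open>(r - 2)\<close>-Leray.

  If the sum of the link-Leray dimensions is negative, every link of a face \<open>V i\<close> has Leray number less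
  than the number of classes that are not faces. Removing first the classes that are faces and then the others
  leads to a filler for no colours at all, which would bound the empty face inside the empty vertex set.
  A colour with at most one vertex leaves no admissible sets; if there are such colours, the first filler is
  constructed for the other colours, in the link of one of these small classes.
\<close>

section \<open>Exterior multiplication and contraction of vertices\<close>

abbreviation keys :: "('a \<Rightarrow>\<^sub>0 int) \<Rightarrow> 'a set" where
  "keys \<equiv> Poly_Mapping.keys"

definition precedes :: "'a \<Rightarrow> 'a \<Rightarrow> bool" where
  "precedes y x \<longleftrightarrow> (y, x) \<in> vertex_order \<and> y \<noteq> x"

lemma precedes_flip: "v \<noteq> w \<Longrightarrow> precedes v w \<longleftrightarrow> \<not> precedes w v"
  using linear_order_vertex_order
  unfolding precedes_def order_on_defs total_on_def antisym_def by blast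

lemma vertex_position_precedes: "vertex_position \<sigma> x = card {y \<in> \<sigma>. precedes y x}"
  unfolding vertex_position_def precedes_def by simp

lemma vertex_position_insert:
  assumes "finite \<sigma>" "w \<notin> \<sigma>"
  shows "vertex_position (insert w \<sigma>) v = vertex_position \<sigma> v + (if precedes w v then 1 else 0)"
proof -
  have "{y \<in> insert w \<sigma>. precedes y v}
      = (if precedes w v then insert w {y \<in> \<sigma>. precedes y v} else {y \<in> \<sigma>. precedes y v})"
    by auto
  then show ?thesis
    using assms by (simp add: vertex_position_precedes)
qed

lemma vertex_position_insert_self: "vertex_position (insert v \<sigma>) v = vertex_position \<sigma> v"
  unfolding vertex_position_def by (rule arg_cong[where f = card]) auto

text \<open>Infinite sets, on which the sign of the position would be meaningless, are sent to \<open>0\<close>; this makes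
  the anticommutation rules unconditional.\<close>

definition contract :: "'a \<Rightarrow> ('a set \<Rightarrow>\<^sub>0 int) \<Rightarrow> ('a set \<Rightarrow>\<^sub>0 int)" where
  "contract v = frag_extend (\<lambda>\<sigma>. if finite \<sigma> \<and> v \<in> \<sigma>
     then frag_cmul ((-1) ^ vertex_position \<sigma> v) (frag_of (\<sigma> - {v})) else 0)"

definition adjoin :: "'a \<Rightarrow> ('a set \<Rightarrow>\<^sub>0 int) \<Rightarrow> ('a set \<Rightarrow>\<^sub>0 int)" where
  "adjoin v = frag_extend (\<lambda>\<sigma>. if finite \<sigma> \<and> v \<notin> \<sigma>
     then frag_cmul ((-1) ^ vertex_position \<sigma> v) (frag_of (insert v \<sigma>)) else 0)"

lemma contract_diff [simp]: "contract v (a - b) = contract v a - contract v b"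
  and contract_0 [simp]: "contract v 0 = 0"
  and contract_minus [simp]: "contract v (- a) = - contract v a"
  and contract_cmul [simp]: "contract v (frag_cmul k a) = frag_cmul k (contract v a)"
  and contract_of: "contract v (frag_of \<sigma>) = (if finite \<sigma> \<and> v \<in> \<sigma>
     then frag_cmul ((-1) ^ vertex_position \<sigma> v) (frag_of (\<sigma> - {v})) else 0)"
  by (simp_all add: contract_def frag_extend_diff frag_extend_minus frag_extend_cmul)

lemma adjoin_diff [simp]: "adjoin v (a - b) = adjoin v a - adjoin v b"
  and adjoin_0 [simp]: "adjoin v 0 = 0"
  and adjoin_cmul [simp]: "adjoin v (frag_cmul k a) = frag_cmul k (adjoin v a)"
  and adjoin_of: "adjoin v (frag_of \<sigma>) = (if finite \<sigma> \<and> v \<notin> \<sigma>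
     then frag_cmul ((-1) ^ vertex_position \<sigma> v) (frag_of (insert v \<sigma>)) else 0)"
  by (simp_all add: adjoin_def frag_extend_diff frag_extend_minus frag_extend_cmul)

text \<open>Additive maps are exactly those that preserve differences, and
  \<open>frag_induction\<close> generates the chains supported on \<open>S\<close> by differences;
  identities between operators thus reduce to single faces.\<close>

lemma frag_eqI:
  assumes "keys c \<subseteq> S"
    and "\<And>\<sigma>. \<sigma> \<in> S \<Longrightarrow> f (frag_of \<sigma>) = g (frag_of \<sigma>)"
    and "\<And>a b. f (a - b) = f a - f b" and "\<And>a b. g (a - b) = g a - g b"
  shows "f c = (g c :: 'b::ab_group_add)"
proof -
  have "f 0 = 0" "g 0 = 0"
    using assms(3)[of 0 0] assms(4)[of 0 0] by simp_all
  with assms(1) show ?thesis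
    by (induction c rule: frag_induction) (simp_all add: assms)
qed

lemma keys_image_subset:
  assumes "keys c \<subseteq> S"
    and "\<And>\<sigma>. \<sigma> \<in> S \<Longrightarrow> keys (f (frag_of \<sigma>)) \<subseteq> T"
    and "\<And>a b. f (a - b) = f a - f b"
  shows "keys (f c :: 'b \<Rightarrow>\<^sub>0 int) \<subseteq> T"
proof -
  have "f 0 = 0"
    using assms(3)[of 0 0] by simp
  with assms(1) show ?thesis
  proof (induction c rule: frag_induction)
    case (diff a b)
    then show ?case
      using keys_diff[of "f a" "f b"] by (auto simp: assms(3))
  qed (simp_all add: assms)
qed

text \<open>Deleting \<open>w\<close> lowers the position of \<open>v\<close> exactly if
  \<open>w\<close> precedes \<open>v\<close>. The result is written with
  \<open>\<sigma> - {v, w}\<close> so that the two orders of deletion can be compared.\<close>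

lemma contract_remove:
  assumes "finite \<sigma>" "w \<in> \<sigma>" "v \<noteq> w"
  shows "contract v (frag_of (\<sigma> - {w})) = (if v \<in> \<sigma> then
     frag_cmul ((if precedes w v then -1 else 1) * (-1) ^ vertex_position \<sigma> v) (frag_of (\<sigma> - {v, w})) else 0)"
proof -
  have "vertex_position \<sigma> v = vertex_position (\<sigma> - {w}) v + (if precedes w v then 1 else 0)"
    using vertex_position_insert[of "\<sigma> - {w}" w v] assms by (simp add: insert_absorb)
  moreover have "\<sigma> - {w} - {v} = \<sigma> - {v, w}"
    by auto
  ultimately show ?thesis
    using assms by (auto simp: contract_of)
qed

text \<open>For \<open>v \<noteq> w\<close> exactly one of the two vertices precedes the other, so
  exactly one order of deletion picks up an extra sign; for \<open>v = w\<close> both sides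
  vanish.\<close>

lemma contract_anticomm: "contract v (contract w c) = - contract w (contract v c)"
proof (cases "v = w")
  case True
  show ?thesis
    unfolding True by (rule frag_eqI[of c UNIV]) (auto simp: contract_of)
next
  case False
  show ?thesis
  proof (rule frag_eqI[of c UNIV])
    fix \<sigma> :: "'a set"
    have 1: "\<sigma> - {w, v} = \<sigma> - {v, w}"
      by auto
    show "contract v (contract w (frag_of \<sigma>)) = - contract w (contract v (frag_of \<sigma>))"
      using False precedes_flip[OF False]
      by (simp add: contract_of[of _ \<sigma>] contract_remove 1 mult.commute)
  qed auto
qed

lemma contract_adjoin:
  assumes "v \<noteq> w"
  shows "contract v (adjoin w c) = - adjoin w (contract v c)"
proof (rule frag_eqI[of c UNIV])
  fix \<sigma> :: "'a set"
  show "contract v (adjoin w (frag_of \<sigma>)) = - adjoin w (contract v (frag_of \<sigma>))"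
  proof (cases "finite \<sigma> \<and> v \<in> \<sigma> \<and> w \<notin> \<sigma>")
    case True
    have "insert w \<sigma> - {v} = insert w (\<sigma> - {v})"
      using assms by auto
    moreover have "vertex_position \<sigma> w = vertex_position (\<sigma> - {v}) w + (if precedes v w then 1 else 0)"
      using vertex_position_insert[of "\<sigma> - {v}" v w] True by (simp add: insert_absorb)
    ultimately show ?thesis
      using True assms precedes_flip[OF assms] by (simp add: contract_of adjoin_of vertex_position_insert mult.commute)
  qed (use assms in \<open>auto simp: contract_of adjoin_of\<close>)
qed auto

text \<open>On a finite face exactly one of the two composites is nonzero, and its signs cancel,
  because the position of \<open>v\<close> does not depend on whether \<open>v\<close> belongs to
  the face. Infinite faces are excluded, as both composites send them to \<open>0\<close>.\<close>

lemma contract_adjoin_self: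
  assumes "keys c \<subseteq> {\<sigma>. finite \<sigma>}"
  shows "contract v (adjoin v c) = c - adjoin v (contract v c)"
proof (rule frag_eqI[of c, OF assms])
  fix \<sigma> :: "'a set" assume "\<sigma> \<in> {\<sigma>. finite \<sigma>}"
  moreover have "vertex_position (\<sigma> - {v}) v = vertex_position \<sigma> v"
    using vertex_position_insert_self[of v "\<sigma> - {v}"] vertex_position_insert_self[of v "\<sigma>"] by simp
  ultimately show "contract v (adjoin v (frag_of \<sigma>)) = frag_of \<sigma> - adjoin v (contract v (frag_of \<sigma>))"
    by (auto simp: contract_of adjoin_of vertex_position_insert_self insert_absorb)
qed auto

section \<open>Boundary operators restricted to a set of vertices\<close>

definition boundary_on :: "'a set \<Rightarrow> ('a set \<Rightarrow>\<^sub>0 int) \<Rightarrow> ('a set \<Rightarrow>\<^sub>0 int)" where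
  "boundary_on S c = (\<Sum>v\<in>S. contract v c)"

lemma boundary_on_diff [simp]: "boundary_on S (a - b) = boundary_on S a - boundary_on S b"
  and boundary_on_0 [simp]: "boundary_on S 0 = 0"
  by (simp_all add: boundary_on_def sum_subtractf sum_negf)

lemma contract_sum: "contract v (sum f S) = (\<Sum>x\<in>S. contract v (f x))"
  and adjoin_sum: "adjoin v (sum f S) = (\<Sum>x\<in>S. adjoin v (f x))"
  by (cases "finite S"; simp add: contract_def adjoin_def frag_extend_sum)+

lemma contract_boundary_on: "contract v (boundary_on S c) = - boundary_on S (contract v c)"
  unfolding boundary_on_def contract_sum sum_negf[symmetric]
  by (rule sum.cong[OF refl], rule contract_anticomm)

lemma boundary_on_anticomm: "boundary_on S (boundary_on T c) = - boundary_on T (boundary_on S c)"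
  unfolding boundary_on_def[of S] contract_boundary_on
  by (simp add: boundary_on_def contract_sum sum_negf sum.swap[of _ S])

lemma boundary_on_twice [simp]: "boundary_on S (boundary_on S c) = 0"
proof (rule poly_mapping_eqI)
  \<comment> \<open>Anticommutation with \<open>T = S\<close> only says that the chain equals its
    own negative; comparing integer coefficients makes it \<open>0\<close>.\<close>
  fix \<sigma> show "Poly_Mapping.lookup (boundary_on S (boundary_on S c)) \<sigma> = Poly_Mapping.lookup 0 \<sigma>"
    using arg_cong[OF boundary_on_anticomm[of S S c], of "\<lambda>x. Poly_Mapping.lookup x \<sigma>"]
    unfolding lookup_uminus by simp
qed

lemma boundary_on_adjoin:
  assumes "finite S" "keys c \<subseteq> {\<sigma>. finite \<sigma>}"
  shows "boundary_on S (adjoin v c) = (if v \<in> S then c else 0) - adjoin v (boundary_on S c)"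
proof -
  have "boundary_on S (adjoin v c) = (\<Sum>w\<in>S. (if w = v then c else 0) - adjoin v (contract w c))"
    unfolding boundary_on_def
    by (rule sum.cong) (auto simp: contract_adjoin contract_adjoin_self[of c, OF assms(2)])
  also have "\<dots> = (if v \<in> S then c else 0) - adjoin v (boundary_on S c)"
    using assms(1) by (simp add: sum_subtractf boundary_on_def adjoin_sum)
  finally show ?thesis .
qed

lemma boundary_map_diff [simp]: "boundary_map (a - b) = boundary_map a - boundary_map b"
  and boundary_map_0 [simp]: "boundary_map 0 = 0"
  and boundary_map_minus [simp]: "boundary_map (- a) = - boundary_map a"
  and boundary_map_add: "boundary_map (a + b) = boundary_map a + boundary_map b"
  by (simp_all add: boundary_map_def frag_extend_diff frag_extend_minus frag_extend_add)

text \<open>Vertices outside a face contribute nothing, so the sum may run over one vertex set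
  common to all faces. This makes the anticommutation rules available for the boundary.\<close>

lemma boundary_map_eq_boundary_on:
  assumes "finite S" "keys c \<subseteq> Pow S"
  shows "boundary_map c = boundary_on S c"
proof (rule frag_eqI[of c, OF assms(2)])
  fix \<sigma> assume "\<sigma> \<in> Pow S"
  then have "finite \<sigma>" "\<sigma> \<subseteq> S"
    using assms(1) finite_subset by auto
  have "boundary_on S (frag_of \<sigma>) = (\<Sum>v\<in>\<sigma>. contract v (frag_of \<sigma>))"
    unfolding boundary_on_def
    by (rule sum.mono_neutral_right) (use assms(1) \<open>\<sigma> \<subseteq> S\<close> in \<open>auto simp: contract_of\<close>)
  also have "\<dots> = boundary_map (frag_of \<sigma>)"
    unfolding boundary_map_def frag_extend_of simplex_boundary_def
    by (rule sum.cong) (use \<open>finite \<sigma>\<close> in \<open>auto simp: contract_of\<close>)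
  finally show "boundary_map (frag_of \<sigma>) = boundary_on S (frag_of \<sigma>)" ..
qed auto

lemma keys_sum_subset: "(\<And>x. x \<in> S \<Longrightarrow> keys (f x) \<subseteq> T) \<Longrightarrow> keys (sum f S) \<subseteq> T"
  using keys_sum[of f S] by blast

lemma keys_boundary_on_of: "keys (boundary_on S (frag_of \<sigma>)) \<subseteq> {\<sigma> - {v} |v. finite \<sigma> \<and> v \<in> \<sigma> \<and> v \<in> S}"
  unfolding boundary_on_def by (rule keys_sum_subset) (auto simp: contract_of)

section \<open>Acyclicity and null homotopies\<close>

text \<open>Chain-level vanishing of the homology of all induced subcomplexes in dimensions at least
  \<open>s - 1\<close>: degrees are counted by \<open>card\<close>, which exceeds the dimension by
  one, so that the empty face has degree \<open>0\<close>.\<close>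

definition acyclic_from :: "'a set set \<Rightarrow> nat \<Rightarrow> bool" where
  "acyclic_from X s \<longleftrightarrow> (\<forall>W c t. s \<le> t \<longrightarrow> keys c \<subseteq> {\<sigma> \<in> X. \<sigma> \<subseteq> W \<and> card \<sigma> = t} \<longrightarrow> boundary_map c = 0 \<longrightarrow>
     (\<exists>b. keys b \<subseteq> {\<sigma> \<in> X. \<sigma> \<subseteq> W \<and> card \<sigma> = t + 1} \<and> boundary_map b = c))"

lemma acyclic_fromD:
  assumes "acyclic_from X s" "s \<le> t" "keys c \<subseteq> {\<sigma> \<in> X. \<sigma> \<subseteq> W \<and> card \<sigma> = t}" "boundary_map c = 0"
  obtains b where "keys b \<subseteq> {\<sigma> \<in> X. \<sigma> \<subseteq> W \<and> card \<sigma> = t + 1}" "boundary_map b = c"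
  using assms(1)[unfolded acyclic_from_def, rule_format, OF assms(2-4)] that by blast

lemma acyclic_from_mono: "acyclic_from X s \<Longrightarrow> s \<le> t \<Longrightarrow> acyclic_from X t"
  unfolding acyclic_from_def by (intro allI impI) (elim allE impE, rule order_trans, assumption+)

section \<open>From vanishing homology groups to filling of cycles\<close>

lemma cycle_imp_boundary:
  assumes "trivial_group (reduced_simplicial_homology_group K i)" "c \<in> simplicial_cycles K i"
  shows "c \<in> simplicial_boundaries K i"
proof -
  let ?G = "simplicial_chain_group K i"
  let ?Z = "subgroup_generated ?G (simplicial_cycles K i)"
  have "c \<in> carrier ?Z"
    using assms(2) by (simp add: generate.incl simplicial_cycles_def carrier_subgroup_generated)
  then have "r_coset ?Z (simplicial_boundaries K i) c \<in> carrier (reduced_simplicial_homology_group K i)"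
    unfolding reduced_simplicial_homology_group_def carrier_FactGroup by blast
  then have *: "r_coset ?Z (simplicial_boundaries K i) c = simplicial_boundaries K i"
    using assms(1) unfolding trivial_group_def by (simp add: reduced_simplicial_homology_group_def)
  \<comment> \<open>Since \<open>0\<close> is a boundary, \<open>c\<close> lies in its own coset,
    which by triviality of the quotient is the set of boundaries itself.\<close>
  have "0 \<in> simplicial_boundaries K i"
    unfolding simplicial_boundaries_def by (rule image_eqI[of _ _ 0]) (simp_all add: simplicial_chain_group_def)
  then have "0 + c \<in> r_coset ?Z (simplicial_boundaries K i) c"
    unfolding r_coset_def by (force simp: simplicial_chain_group_def)
  then show ?thesis
    unfolding * by simp
qed

lemma trivial_homology_if_no_faces:
  assumes "faces K i = {}" "faces K (i + 1) = {}"
  shows "trivial_group (reduced_simplicial_homology_group K i)"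
proof -
  let ?G = "simplicial_chain_group K i"
  let ?Z = "subgroup_generated ?G (simplicial_cycles K i)"
  have G: "carrier ?G = {0}"
    by (auto simp: simplicial_chain_group_def assms)
  have B: "simplicial_boundaries K i = {\<one>\<^bsub>?Z\<^esub>}"
    by (auto simp: simplicial_boundaries_def simplicial_chain_group_def assms)
  interpret G: group ?G
    by (simp add: simplicial_chain_group_def)
  interpret Z: group ?Z
    by (rule G.group_subgroup_generated)
  have Z: "carrier ?Z = {\<one>\<^bsub>?Z\<^esub>}"
    using G G.carrier_subgroup_generated_subset[of "simplicial_cycles K i"] Z.one_closed
    by (auto simp: simplicial_chain_group_def)
  have "group (?Z Mod {\<one>\<^bsub>?Z\<^esub>})"
    using Z.one_is_normal by (rule normal.factorgroup_is_group)
  moreover have "carrier (?Z Mod {\<one>\<^bsub>?Z\<^esub>}) = {{\<one>\<^bsub>?Z\<^esub>}}"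
    unfolding carrier_FactGroup Z by (simp add: r_coset_def)
  ultimately show ?thesis
    unfolding trivial_group_def reduced_simplicial_homology_group_def B by simp
qed

lemma trivial_homology_large:
  assumes "simplicial_complex K" "int (card (\<Union>K)) \<le> i"
  shows "trivial_group (reduced_simplicial_homology_group (induced_subcomplex K W) i)"
proof -
  have "finite (\<Union>K)"
    using assms(1) by (auto simp: simplicial_complex_def)
  then have "card \<sigma> \<le> card (\<Union>K)" if "\<sigma> \<in> K" for \<sigma>
    using that by (intro card_mono) auto
  then have "faces (induced_subcomplex K W) j = {}" if "i \<le> j" for j
    using assms(2) that by (fastforce simp: faces_def induced_subcomplex_def)
  then show ?thesis
    by (intro trivial_homology_if_no_faces) simp_all
qed

lemma Leray_number_trivial:
  assumes "simplicial_complex K" "int (Leray_number K) \<le> i" "W \<subseteq> vertices K"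
  shows "trivial_group (reduced_simplicial_homology_group (induced_subcomplex K W) i)"
proof -
  let ?P = "\<lambda>j. \<forall>W\<subseteq>vertices K. \<forall>i\<ge>int j.
        trivial_group (reduced_simplicial_homology_group (induced_subcomplex K W) i)"
  \<comment> \<open>\<open>LEAST\<close> has its property only if some number does. The number of
    vertices does, as no face has so large a dimension.\<close>
  have "?P (card (\<Union>K))"
    using trivial_homology_large[OF assms(1)] by auto
  then have "?P (Leray_number K)"
    unfolding Leray_number_def by (rule LeastI)
  then show ?thesis
    using assms by auto
qed

text \<open>A face with \<open>t\<close> vertices has dimension \<open>t - 1\<close>, hence the
  shift by one.\<close>

lemma acyclic_from_Leray:
  assumes "simplicial_complex K"
  shows "acyclic_from K (Leray_number K + 1)"
  unfolding acyclic_from_def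
proof (intro allI impI)
  fix W c t
  assume t: "Leray_number K + 1 \<le> t" and c: "keys c \<subseteq> {\<sigma> \<in> K. \<sigma> \<subseteq> W \<and> card \<sigma> = t}"
    and "boundary_map c = 0"
  \<comment> \<open>The Leray number only tests sets of vertices of \<open>K\<close>; the
    intersection leaves the faces inside \<open>W\<close> unchanged.\<close>
  let ?K = "induced_subcomplex K (W \<inter> vertices K)"
  have faces: "faces ?K (int s - 1) = {\<sigma> \<in> K. \<sigma> \<subseteq> W \<and> card \<sigma> = s}" for s
    unfolding faces_def induced_subcomplex_def vertices_def by auto
  have "trivial_group (reduced_simplicial_homology_group ?K (int t - 1))"
    using t by (intro Leray_number_trivial assms) auto
  moreover have "c \<in> simplicial_cycles ?K (int t - 1)"
    using c \<open>boundary_map c = 0\<close> by (simp add: simplicial_cycles_def simplicial_chain_group_def faces)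
  ultimately have "c \<in> simplicial_boundaries ?K (int t - 1)"
    by (rule cycle_imp_boundary)
  then obtain b where "b \<in> carrier (simplicial_chain_group ?K (int (t + 1) - 1))" "c = boundary_map b"
    unfolding simplicial_boundaries_def by auto
  then show "\<exists>b. keys b \<subseteq> {\<sigma> \<in> K. \<sigma> \<subseteq> W \<and> card \<sigma> = t + 1} \<and> boundary_map b = c"
    unfolding simplicial_chain_group_def faces carrier_free_Abelian_group_iff by blast
qed

lemma simplicial_complex_link:
  assumes "simplicial_complex K" "\<tau> \<in> K"
  shows "simplicial_complex (link K \<tau>)"
  unfolding simplicial_complex_def
proof (intro conjI ballI allI impI)
  have "{} \<in> K"
    using assms by (auto simp: simplicial_complex_def)
  then show "link K \<tau> \<noteq> {}"
    using assms(2) by (auto simp: link_def)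
  show "finite (link K \<tau>)"
    using assms(1) unfolding link_def simplicial_complex_def by simp
next
  fix \<sigma> \<rho> assume "\<sigma> \<in> link K \<tau>"
  then show "finite \<sigma>"
    using assms(1) by (auto simp: link_def simplicial_complex_def)
  assume "\<rho> \<subseteq> \<sigma>"
  then have "\<rho> \<union> \<tau> \<subseteq> \<sigma> \<union> \<tau>"
    by auto
  then show "\<rho> \<in> link K \<tau>"
    using \<open>\<sigma> \<in> link K \<tau>\<close> \<open>\<rho> \<subseteq> \<sigma>\<close> assms(1) unfolding link_def simplicial_complex_def by blast
qed

section \<open>Construction of null homotopies\<close>

lemma boundary_map_twice:
  assumes "finite S" "keys c \<subseteq> Pow S"
  shows "boundary_map (boundary_map c) = 0"
proof -
  have "keys (boundary_on S c) \<subseteq> Pow S"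
    by (rule keys_image_subset[of c, OF assms(2)]) (use keys_boundary_on_of in force)+
  then show ?thesis
    using assms by (simp add: boundary_map_eq_boundary_on)
qed

lemma keys_boundary_map_of:
  assumes "finite \<sigma>"
  shows "keys (boundary_map (frag_of \<sigma>)) \<subseteq> {\<sigma> - {v} |v. v \<in> \<sigma>}"
  using keys_boundary_on_of[of \<sigma> \<sigma>] assms by (simp add: boundary_map_eq_boundary_on[of \<sigma>])

text \<open>An acyclic carrier argument. \<open>g\<close> is a chain map that lowers
  \<open>card\<close> by \<open>q\<close>, defined on the complex spanned by the sets with
  \<open>P\<close>, all other sets counting as \<open>0\<close>. The values \<open>h A\<close> are
  chosen by induction on \<open>card A\<close>: what remains to be bounded is a cycle inside
  \<open>A\<close>, and \<open>low\<close> puts it into the range where \<open>X\<close> is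
  acyclic.\<close>

lemma null_homotopy:
  fixes g :: "'a set \<Rightarrow> ('a set \<Rightarrow>\<^sub>0 int)"
  assumes fin: "\<And>A. P A \<Longrightarrow> finite A"
    and convex: "\<And>A B C. P A \<Longrightarrow> P C \<Longrightarrow> C \<subseteq> B \<Longrightarrow> B \<subseteq> A \<Longrightarrow> P B"
    and X: "acyclic_from X s"
    and low: "\<And>A. P A \<Longrightarrow> s + q \<le> card A"
    and supp: "\<And>A. P A \<Longrightarrow> keys (g A) \<subseteq> {\<sigma> \<in> X. \<sigma> \<subseteq> A \<and> card \<sigma> + q = card A}"
    and zero: "\<And>A. \<not> P A \<Longrightarrow> g A = 0"
    and chain: "\<And>A. P A \<Longrightarrow> boundary_map (g A) = frag_extend g (boundary_map (frag_of A))"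
    and bound: "\<And>A. P A \<Longrightarrow> card A < m"
  obtains h where "\<And>A. P A \<Longrightarrow> keys (h A) \<subseteq> {\<sigma> \<in> X. \<sigma> \<subseteq> A \<and> card \<sigma> + q = card A + 1}"
    "\<And>A. \<not> P A \<Longrightarrow> h A = 0"
    "\<And>A. P A \<Longrightarrow> boundary_map (h A) + frag_extend h (boundary_map (frag_of A)) = g A"
proof -
  \<comment> \<open>Only the homotopy equation is limited to sets with fewer than \<open>n\<close>
    elements; support and vanishing are demanded of all sets, so the zero map starts the
    induction.\<close>
  have "\<exists>h. (\<forall>A. P A \<longrightarrow> keys (h A) \<subseteq> {\<sigma> \<in> X. \<sigma> \<subseteq> A \<and> card \<sigma> + q = card A + 1})
      \<and> (\<forall>A. \<not> P A \<longrightarrow> h A = 0)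
      \<and> (\<forall>A. P A \<and> card A < n \<longrightarrow> boundary_map (h A) + frag_extend h (boundary_map (frag_of A)) = g A)"
    for n
  proof (induction n)
    case 0
    show ?case
      by (rule exI[of _ "\<lambda>_. 0"]) simp
  next
    case (Suc n)
    then obtain h where
      h_supp: "\<And>A. P A \<Longrightarrow> keys (h A) \<subseteq> {\<sigma> \<in> X. \<sigma> \<subseteq> A \<and> card \<sigma> + q = card A + 1}" and
      h_zero: "\<And>A. \<not> P A \<Longrightarrow> h A = 0" and
      h_bd: "\<And>A. P A \<Longrightarrow> card A < n \<Longrightarrow> boundary_map (h A) + frag_extend h (boundary_map (frag_of A)) = g A"
      by blast
    let ?Q = "\<lambda>A b. keys b \<subseteq> {\<sigma> \<in> X. \<sigma> \<subseteq> A \<and> card \<sigma> + q = card A + 1}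
      \<and> boundary_map b + frag_extend h (boundary_map (frag_of A)) = g A"
    have ex: "\<exists>b. ?Q A b" if A: "P A" "card A = n" for A
    proof -
      have finA: "finite A"
        using fin A by blast
      have bdA: "keys (boundary_map (frag_of A)) \<subseteq> {A - {v} |v. v \<in> A}"
        by (rule keys_boundary_map_of[OF finA])
      \<comment> \<open>The chain that the new value at \<open>A\<close> has to bound.\<close>
      define z where "z = g A - frag_extend h (boundary_map (frag_of A))"
      have "keys (frag_extend h (boundary_map (frag_of A))) \<subseteq> {\<sigma> \<in> X. \<sigma> \<subseteq> A \<and> card \<sigma> + q = card A}"
      proof (rule keys_image_subset[of "boundary_map (frag_of A)", OF bdA])
        fix B assume "B \<in> {A - {v} |v. v \<in> A}"
        then have "B \<subseteq> A" "card B + 1 = card A"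
          using card_Suc_Diff1[OF finA] by auto
        then show "keys (frag_extend h (frag_of B)) \<subseteq> {\<sigma> \<in> X. \<sigma> \<subseteq> A \<and> card \<sigma> + q = card A}"
          using h_supp[of B] h_zero[of B] by (cases "P B") auto
      qed (simp add: frag_extend_diff)
      then have z_supp: "keys z \<subseteq> {\<sigma> \<in> X. \<sigma> \<subseteq> A \<and> card \<sigma> = card A - q}"
        unfolding z_def using keys_diff[of "g A" "frag_extend h (boundary_map (frag_of A))"] supp[OF A(1)]
        by fastforce
      have "boundary_map (frag_extend h (boundary_map (frag_of A))) =
          frag_extend g (boundary_map (frag_of A)) - frag_extend h (boundary_map (boundary_map (frag_of A)))"
      proof (rule frag_eqI[of "boundary_map (frag_of A)", OF bdA])
        fix B assume "B \<in> {A - {v} |v. v \<in> A}"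
        then have B: "B \<subseteq> A" "card B < n"
          using card_Diff1_less[OF finA] A(2) by auto
        show "boundary_map (frag_extend h (frag_of B)) =
            frag_extend g (frag_of B) - frag_extend h (boundary_map (frag_of B))"
        proof (cases "P B")
          case True
          then show ?thesis
            using h_bd[OF True B(2)] by (simp add: algebra_simps)
        next
          \<comment> \<open>A facet of \<open>B\<close> satisfying \<open>P\<close> would force
            \<open>P B\<close>, as \<open>B\<close> lies between that facet and \<open>A\<close>.
            Hence every term vanishes.\<close>
          case False
          have "keys (boundary_map (frag_of B)) \<subseteq> {C. \<not> P C}"
            using keys_boundary_map_of[of B] convex[OF A(1), of _ B] False B(1) finite_subset[OF B(1) finA]
            by blast
          then have "frag_extend h (boundary_map (frag_of B)) = 0"
            by (intro frag_extend_eq_0 h_zero) auto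
          then show ?thesis
            using False by (simp add: h_zero zero)
        qed
      qed (simp_all add: frag_extend_diff)
      then have z_bd: "boundary_map z = 0"
        unfolding z_def using chain[OF A(1)] boundary_map_twice[of A "frag_of A"] finA by simp
      obtain b where b: "keys b \<subseteq> {\<sigma> \<in> X. \<sigma> \<subseteq> A \<and> card \<sigma> = card A - q + 1}" "boundary_map b = z"
      proof (rule acyclic_fromD[OF X _ z_supp])
        show "s \<le> card A - q"
          using low[OF A(1)] by simp
      qed (rule z_bd)
      \<comment> \<open>\<open>low\<close> also guarantees that the subtraction of \<open>q\<close>
        is not truncated.\<close>
      have "card A - q + 1 + q = card A + 1"
        using low[OF A(1)] by simp
      then have "?Q A b"
        using b unfolding z_def by auto
      then show ?thesis ..
    qed
    \<comment> \<open>New values are given only to sets with \<open>n\<close> elements. Facets of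
      sets with at most \<open>n\<close> elements are smaller, so the earlier equations
      persist.\<close>
    define h' where "h' A = (if P A \<and> card A = n then SOME b. ?Q A b else h A)" for A
    have h': "?Q A (h' A)" if "P A" "card A = n" for A
      using someI_ex[OF ex[OF that]] that by (simp add: h'_def)
    have h'_bd: "frag_extend h' (boundary_map (frag_of A)) = frag_extend h (boundary_map (frag_of A))"
      if A: "P A" "card A \<le> n" for A
    proof (rule frag_extend_eq)
      fix B assume "B \<in> keys (boundary_map (frag_of A))"
      then obtain v where "B = A - {v}" "v \<in> A"
        using keys_boundary_map_of[OF fin[OF A(1)]] by blast
      then have "card B < card A"
        using card_Diff1_less[OF fin[OF A(1)]] by simp
      then show "h' B = h B"
        using A by (simp add: h'_def)
    qed
    show ?case
    proof (intro exI[of _ h'] conjI allI impI)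
      fix A assume "P A"
      then show "keys (h' A) \<subseteq> {\<sigma> \<in> X. \<sigma> \<subseteq> A \<and> card \<sigma> + q = card A + 1}"
        using h'[of A] h_supp[of A] unfolding h'_def by presburger
    next
      fix A assume "\<not> P A"
      then show "h' A = 0"
        by (simp add: h'_def h_zero)
    next
      fix A assume "P A \<and> card A < Suc n"
      then have A: "P A" "card A \<le> n"
        by simp_all
      have "boundary_map (h' A) + frag_extend h (boundary_map (frag_of A)) = g A"
      proof (cases "card A = n")
        case True
        then show ?thesis
          using h' A by blast
      next
        case False
        then have "h' A = h A"
          unfolding h'_def by simp
        then show ?thesis
          using h_bd[OF A(1)] A(2) False by simp
      qed
      then show "boundary_map (h' A) + frag_extend h' (boundary_map (frag_of A)) = g A"
        unfolding h'_bd[OF A] .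
    qed
  qed
  from this[of m] obtain h where h:
    "\<forall>A. P A \<longrightarrow> keys (h A) \<subseteq> {\<sigma> \<in> X. \<sigma> \<subseteq> A \<and> card \<sigma> + q = card A + 1}"
    "\<forall>A. \<not> P A \<longrightarrow> h A = 0"
    "\<forall>A. P A \<and> card A < m \<longrightarrow> boundary_map (h A) + frag_extend h (boundary_map (frag_of A)) = g A"
    by (elim exE conjE)
  show ?thesis
    by (rule that[of h]) (use h bound in simp_all)
qed

section \<open>Colour-wise boundaries\<close>

lemma boundary_on_cmul: "boundary_on S (frag_cmul k c) = frag_cmul k (boundary_on S c)"
  by (simp add: boundary_on_def frag_cmul_sum)

text \<open>The colours form a list because the operators anticommute: their order fixes the
  sign.\<close>

primrec colour_boundary :: "('i \<Rightarrow> 'a set) \<Rightarrow> 'i list \<Rightarrow> ('a set \<Rightarrow>\<^sub>0 int) \<Rightarrow> ('a set \<Rightarrow>\<^sub>0 int)" where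
  "colour_boundary V [] c = c"
| "colour_boundary V (i # is) c = boundary_on (V i) (colour_boundary V is c)"

lemma colour_boundary_diff [simp]: "colour_boundary V is (a - b) = colour_boundary V is a - colour_boundary V is b"
  by (induction "is") simp_all

lemma colour_boundary_0 [simp]: "colour_boundary V is 0 = 0"
  by (induction "is") simp_all

lemma colour_boundary_cmul: "colour_boundary V is (frag_cmul k a) = frag_cmul k (colour_boundary V is a)"
  by (induction "is") (simp_all add: boundary_on_cmul)

lemma colour_boundary_sum: "colour_boundary V is (sum f S) = (\<Sum>x\<in>S. colour_boundary V is (f x))"
proof (induction S rule: infinite_finite_induct)
  case (insert x S)
  have "colour_boundary V is (f x + sum f S) = colour_boundary V is (f x - (0 - sum f S))"
    by simp
  then show ?case
    unfolding sum.insert[OF insert.hyps] insert.IH[symmetric] colour_boundary_diff by simp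
qed simp_all

lemma boundary_on_colour_boundary:
  "boundary_on S (colour_boundary V is c) = frag_cmul ((-1) ^ length is) (colour_boundary V is (boundary_on S c))"
proof (induction "is")
  case (Cons i "is")
  then show ?case
    by (simp add: boundary_on_anticomm[of S] boundary_on_cmul)
qed simp

text \<open>Moved past the other colours at the cost of signs, the operator meets its own copy, and
  its square is \<open>0\<close>.\<close>

lemma boundary_on_colour [simp]:
  "i \<in> set is \<Longrightarrow> boundary_on (V i) (colour_boundary V is c) = 0"
proof (induction "is")
  case (Cons j "is")
  then show ?case
    by (auto simp: boundary_on_anticomm[of "V i"])
qed simp

lemma colour_boundary_on_colour:
  assumes "i \<in> set is"
  shows "colour_boundary V is (boundary_on (V i) c) = 0"
  using boundary_on_colour_boundary[of "V i" V "is" c] boundary_on_colour[OF assms, of V c] by simp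

section \<open>Coloured vertex sets and their transversal cycles\<close>

locale coloured_vertices =
  fixes V :: "'i \<Rightarrow> 'a set" and "is" :: "'i list"
  assumes distinct: "distinct is"
    and disj: "disjoint_family_on V (set is)"
    and fin: "\<And>i. i \<in> set is \<Longrightarrow> finite (V i)"
begin

abbreviation U :: "'a set" where
  "U \<equiv> (\<Union>i\<in>set is. V i)"

definition admissible :: "'a set \<Rightarrow> bool" where
  "admissible A \<longleftrightarrow> A \<subseteq> U \<and> (\<forall>i\<in>set is. 2 \<le> card (A \<inter> V i))"

definition multicoloured :: "nat \<Rightarrow> 'a set \<Rightarrow> bool" where
  "multicoloured m A \<longleftrightarrow> A \<subseteq> U \<and> (\<forall>i\<in>set is. card (A \<inter> V i) = m)"

text \<open>Up to sign, the fundamental cycle of the boundary of the cross-polytope whose pairs of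
  opposite vertices are the sets \<open>A \<inter> V i\<close>.\<close>

definition transversal_cycle :: "'a set \<Rightarrow> ('a set \<Rightarrow>\<^sub>0 int)" where
  "transversal_cycle A = (if multicoloured 2 A then colour_boundary V is (frag_of A) else 0)"

lemma finite_U: "finite U"
  using fin by auto

lemma admissible_finite: "admissible A \<Longrightarrow> finite A"
  using finite_U finite_subset unfolding admissible_def by blast

lemma boundary_on_U: "boundary_on U c = (\<Sum>i\<in>set is. boundary_on (V i) c)"
  unfolding boundary_on_def
  by (rule sum.UNION_disjoint) (use disj fin in \<open>auto simp: disjoint_family_on_def\<close>)

lemma boundary_colour_boundary [simp]: "boundary_on U (colour_boundary V is c) = 0"
  by (simp add: boundary_on_U)

lemma colour_boundary_boundary: "colour_boundary V is (boundary_on U c) = 0"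
  by (simp add: boundary_on_U colour_boundary_sum colour_boundary_on_colour)

lemma card_colours:
  assumes "A \<subseteq> U"
  shows "card A = (\<Sum>i\<in>set is. card (A \<inter> V i))"
proof -
  have "card (\<Union>i\<in>set is. A \<inter> V i) = (\<Sum>i\<in>set is. card (A \<inter> V i))"
    by (rule card_UN_disjoint) (use disj fin in \<open>auto simp: disjoint_family_on_def\<close>)
  moreover have "(\<Union>i\<in>set is. A \<inter> V i) = A"
    using assms by auto
  ultimately show ?thesis
    by simp
qed

lemma card_set_is: "card (set is) = length is"
  using distinct by (rule distinct_card)

lemma multicoloured_card: "multicoloured m A \<Longrightarrow> card A = m * length is"
  unfolding multicoloured_def using card_colours[of A] by (simp add: card_set_is)

lemma admissible_card: "admissible A \<Longrightarrow> 2 * length is \<le> card A"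
  unfolding admissible_def using card_colours[of A] sum_mono[of "set is" "\<lambda>_. 2" "\<lambda>i. card (A \<inter> V i)"]
  by (simp add: card_set_is)

lemma multicoloured_imp_admissible: "multicoloured 2 A \<Longrightarrow> admissible A"
  unfolding multicoloured_def admissible_def by simp

lemma admissible_mono:
  assumes "admissible C" "C \<subseteq> A" "A \<subseteq> U"
  shows "admissible A"
  unfolding admissible_def
proof
  show "\<forall>i\<in>set is. 2 \<le> card (A \<inter> V i)"
  proof
    fix i assume i: "i \<in> set is"
    have "card (C \<inter> V i) \<le> card (A \<inter> V i)"
      using assms(2) fin[OF i] by (intro card_mono) auto
    then show "2 \<le> card (A \<inter> V i)"
      using assms(1) i unfolding admissible_def by fastforce
  qed
qed (rule assms(3))

lemma admissible_convex: "admissible A \<Longrightarrow> admissible C \<Longrightarrow> C \<subseteq> B \<Longrightarrow> B \<subseteq> A \<Longrightarrow> admissible B"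
  by (erule admissible_mono[of C B], assumption) (auto simp: admissible_def)

end

text \<open>Each operator deletes one vertex of its own colour, and \<open>T\<close> collects the
  deleted vertices. Stated outside the locale because the induction changes the list of
  colours.\<close>

lemma keys_colour_boundary:
  assumes "finite A" "distinct is" "disjoint_family_on V (set is)"
  shows "keys (colour_boundary V is (frag_of A)) \<subseteq> {A - T |T. T \<subseteq> A \<and> T \<subseteq> (\<Union>i\<in>set is. V i) \<and>
    (\<forall>i\<in>set is. card (T \<inter> V i) = 1)}"
  using assms(2,3)
proof (induction "is")
  case Nil
  then show ?case
    by auto
next
  case (Cons i "is")
  let ?S = "{A - T |T. T \<subseteq> A \<and> T \<subseteq> (\<Union>i\<in>set is. V i) \<and> (\<forall>i\<in>set is. card (T \<inter> V i) = 1)}"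
  have IH: "keys (colour_boundary V is (frag_of A)) \<subseteq> ?S"
    using Cons by (auto simp: disjoint_family_on_def)
  have disj: "V i \<inter> V j = {}" if "j \<in> set is" for j
    using Cons.prems that by (auto simp: disjoint_family_on_def)
  show ?case
    unfolding colour_boundary.simps
  proof (rule keys_image_subset[of "colour_boundary V is (frag_of A)", OF IH])
    fix B assume "B \<in> ?S"
    then obtain T where T: "B = A - T" "T \<subseteq> A" "T \<subseteq> (\<Union>i\<in>set is. V i)"
      "\<And>j. j \<in> set is \<Longrightarrow> card (T \<inter> V j) = 1"
      by blast
    show "keys (boundary_on (V i) (frag_of B)) \<subseteq> {A - T |T. T \<subseteq> A \<and> T \<subseteq> (\<Union>i\<in>set (i # is). V i) \<and>
        (\<forall>i\<in>set (i # is). card (T \<inter> V i) = 1)}"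
    proof
      fix \<sigma> assume "\<sigma> \<in> keys (boundary_on (V i) (frag_of B))"
      then obtain v where v: "\<sigma> = B - {v}" "v \<in> B" "v \<in> V i"
        using keys_boundary_on_of by blast
      have 1: "insert v T \<inter> V i = {v}"
        using T(3) v(3) disj by auto
      have 2: "insert v T \<inter> V j = T \<inter> V j" if "j \<in> set is" for j
        using disj[OF that] v(3) by auto
      have "\<forall>j\<in>set (i # is). card (insert v T \<inter> V j) = 1"
        using 1 2 T(4) by simp
      moreover have "\<sigma> = A - insert v T" "insert v T \<subseteq> A" "insert v T \<subseteq> (\<Union>i\<in>set (i # is). V i)"
        using v T by auto
      ultimately show "\<sigma> \<in> {A - T |T. T \<subseteq> A \<and> T \<subseteq> (\<Union>i\<in>set (i # is). V i) \<and>
          (\<forall>i\<in>set (i # is). card (T \<inter> V i) = 1)}"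
        by blast
    qed
  qed simp
qed

context coloured_vertices
begin

lemma keys_colour_boundary_card:
  assumes "A \<subseteq> U" "\<sigma> \<in> keys (colour_boundary V is (frag_of A))"
  shows "\<sigma> \<subseteq> A" and "\<And>i. i \<in> set is \<Longrightarrow> card (\<sigma> \<inter> V i) + 1 = card (A \<inter> V i)"
proof -
  have "finite A"
    using assms(1) finite_U finite_subset by blast
  from subsetD[OF keys_colour_boundary[OF this distinct disj] assms(2)]
  obtain T where T: "\<sigma> = A - T" "T \<subseteq> A" "\<And>i. i \<in> set is \<Longrightarrow> card (T \<inter> V i) = 1"
    by auto
  then show "\<sigma> \<subseteq> A"
    by simp
  fix i assume i: "i \<in> set is"
  have "A \<inter> V i = (\<sigma> \<inter> V i) \<union> (T \<inter> V i)" "(\<sigma> \<inter> V i) \<inter> (T \<inter> V i) = {}"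
    using T by auto
  then show "card (\<sigma> \<inter> V i) + 1 = card (A \<inter> V i)"
    using card_Un_disjoint[of "\<sigma> \<inter> V i" "T \<inter> V i"] fin[OF i] T(3)[OF i] by simp
qed

lemma keys_transversal_cycle:
  "keys (transversal_cycle A) \<subseteq> {\<sigma>. multicoloured 1 \<sigma> \<and> \<sigma> \<subseteq> A \<and> card \<sigma> + length is = card A}"
proof (cases "multicoloured 2 A")
  case True
  have A: "A \<subseteq> U"
    using True by (simp add: multicoloured_def)
  show ?thesis
  proof
    fix \<sigma> assume "\<sigma> \<in> keys (transversal_cycle A)"
    then have \<sigma>: "\<sigma> \<in> keys (colour_boundary V is (frag_of A))"
      using True by (simp add: transversal_cycle_def)
    have "card (\<sigma> \<inter> V i) = 1" if "i \<in> set is" for i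
      using keys_colour_boundary_card(2)[OF A \<sigma> that] True that by (simp add: multicoloured_def)
    then have "multicoloured 1 \<sigma>" "\<sigma> \<subseteq> A"
      using keys_colour_boundary_card(1)[OF A \<sigma>] A by (auto simp: multicoloured_def)
    then show "\<sigma> \<in> {\<sigma>. multicoloured 1 \<sigma> \<and> \<sigma> \<subseteq> A \<and> card \<sigma> + length is = card A}"
      using multicoloured_card[OF True] multicoloured_card[of 1 \<sigma>] by simp
  qed
qed (simp add: transversal_cycle_def)

lemma boundary_transversal_cycle: "boundary_map (transversal_cycle A) = 0"
proof -
  have "keys (transversal_cycle A) \<subseteq> Pow U"
    using keys_transversal_cycle[of A] by (auto simp: multicoloured_def)
  then show ?thesis
    by (simp add: boundary_map_eq_boundary_on[OF finite_U] transversal_cycle_def)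
qed

text \<open>Inside \<open>U\<close> the case distinction of \<open>transversal_cycle\<close> amounts
  to a linear projection \<open>\<pi>\<close> applied after \<open>colour_boundary V is\<close>: one
  vertex of each colour is left exactly if there were two. The claim follows because
  \<open>colour_boundary V is\<close> annihilates boundaries.\<close>

lemma transversal_cycle_boundary:
  assumes "A \<subseteq> U"
  shows "frag_extend transversal_cycle (boundary_map (frag_of A)) = 0"
proof -
  define \<pi> :: "('a set \<Rightarrow>\<^sub>0 int) \<Rightarrow> ('a set \<Rightarrow>\<^sub>0 int)"
    where "\<pi> = frag_extend (\<lambda>\<sigma>. if multicoloured 1 \<sigma> then frag_of \<sigma> else 0)"
  have \<pi>: "transversal_cycle B = \<pi> (colour_boundary V is (frag_of B))" if "B \<subseteq> U" for B
  proof (cases "multicoloured 2 B")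
    case True
    have "\<pi> (colour_boundary V is (frag_of B)) = frag_extend frag_of (colour_boundary V is (frag_of B))"
      unfolding \<pi>_def
      by (rule frag_extend_eq) (use keys_transversal_cycle[of B] True in \<open>auto simp: transversal_cycle_def\<close>)
    then show ?thesis
      using True by (simp add: transversal_cycle_def frag_expansion[symmetric])
  next
    case False
    have "\<not> multicoloured 1 \<sigma>" if "\<sigma> \<in> keys (colour_boundary V is (frag_of B))" for \<sigma>
      using False keys_colour_boundary_card(2)[OF \<open>B \<subseteq> U\<close> that] \<open>B \<subseteq> U\<close>
      unfolding multicoloured_def by fastforce
    then have "\<pi> (colour_boundary V is (frag_of B)) = 0"
      unfolding \<pi>_def by (intro frag_extend_eq_0) simp
    then show ?thesis
      using False by (simp add: transversal_cycle_def)
  qed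
  have "keys (boundary_on U (frag_of A)) \<subseteq> Pow U"
    using keys_boundary_on_of[of U A] assms by blast
  then have "frag_extend transversal_cycle (boundary_on U (frag_of A)) = \<pi> (colour_boundary V is (boundary_on U (frag_of A)))"
    by (rule frag_eqI[where f = "frag_extend transversal_cycle" and g = "\<lambda>c. \<pi> (colour_boundary V is c)"])
      (simp_all add: \<pi> frag_extend_diff \<pi>_def)
  also have "\<dots> = 0"
    by (simp add: colour_boundary_boundary \<pi>_def)
  finally show ?thesis
    using assms by (simp add: boundary_map_eq_boundary_on[OF finite_U])
qed

end

section \<open>Adjoining and contracting lists of vertices\<close>

primrec adjoin_list :: "'a list \<Rightarrow> ('a set \<Rightarrow>\<^sub>0 int) \<Rightarrow> ('a set \<Rightarrow>\<^sub>0 int)" where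
  "adjoin_list [] c = c"
| "adjoin_list (v # vs) c = adjoin v (adjoin_list vs c)"

text \<open>The head is adjoined last and contracted first. Thus contraction undoes, without a sign,
  the adjunction of distinct new vertices to finite faces.\<close>

primrec contract_list :: "'a list \<Rightarrow> ('a set \<Rightarrow>\<^sub>0 int) \<Rightarrow> ('a set \<Rightarrow>\<^sub>0 int)" where
  "contract_list [] c = c"
| "contract_list (v # vs) c = contract_list vs (contract v c)"

definition avoid :: "'a set \<Rightarrow> ('a set \<Rightarrow>\<^sub>0 int) \<Rightarrow> ('a set \<Rightarrow>\<^sub>0 int)" where
  "avoid S = frag_extend (\<lambda>\<sigma>. if \<sigma> \<inter> S = {} then frag_of \<sigma> else 0)"

text \<open>Up to sign, \<open>residue S vs c\<close> is the part of \<open>c\<close> on the faces \<open>\<sigma>\<close> with \<open>\<sigma> \<inter> S = set vs\<close>, with \<open>vs\<close>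
  removed (for \<open>set vs \<subseteq> S\<close>).\<close>

definition residue :: "'a set \<Rightarrow> 'a list \<Rightarrow> ('a set \<Rightarrow>\<^sub>0 int) \<Rightarrow> ('a set \<Rightarrow>\<^sub>0 int)" where
  "residue S vs c = avoid S (contract_list vs c)"

lemma adjoin_list_diff [simp]: "adjoin_list vs (a - b) = adjoin_list vs a - adjoin_list vs b"
  by (induction vs) simp_all

lemma contract_list_diff [simp]: "contract_list vs (a - b) = contract_list vs a - contract_list vs b"
  by (induction vs arbitrary: a b) simp_all

lemma contract_list_cmul [simp]: "contract_list vs (frag_cmul k a) = frag_cmul k (contract_list vs a)"
  by (induction vs arbitrary: a) simp_all

lemma avoid_diff [simp]: "avoid S (a - b) = avoid S a - avoid S b"
  and avoid_add: "avoid S (a + b) = avoid S a + avoid S b"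
  and avoid_cmul [simp]: "avoid S (frag_cmul k a) = frag_cmul k (avoid S a)"
  and avoid_of: "avoid S (frag_of \<sigma>) = (if \<sigma> \<inter> S = {} then frag_of \<sigma> else 0)"
  by (simp_all add: avoid_def frag_extend_diff frag_extend_cmul frag_extend_add)

lemma residue_diff [simp]: "residue S vs (a - b) = residue S vs a - residue S vs b"
  and residue_cmul [simp]: "residue S vs (frag_cmul k a) = frag_cmul k (residue S vs a)"
  by (simp_all add: residue_def)

lemma residue_0 [simp]: "residue S vs 0 = 0"
  using residue_diff[of S vs 0 0] by simp

lemma residue_add: "residue S vs (a + b) = residue S vs a + residue S vs b"
  using residue_diff[of S vs "a + b" b] by (simp add: algebra_simps)

lemma adjoin_list_of:
  assumes "finite B" "distinct vs" "set vs \<inter> B = {}"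
  shows "\<exists>k. \<bar>k\<bar> = 1 \<and> adjoin_list vs (frag_of B) = frag_cmul k (frag_of (set vs \<union> B))"
  using assms(2,3)
proof (induction vs)
  case Nil
  then show ?case
    by (intro exI[of _ 1]) simp
next
  case (Cons v vs)
  then obtain k where "\<bar>k\<bar> = 1" "adjoin_list vs (frag_of B) = frag_cmul k (frag_of (set vs \<union> B))"
    by auto
  then show ?case
    using Cons.prems assms(1)
    by (intro exI[of _ "k * (-1) ^ vertex_position (set vs \<union> B) v"]) (auto simp: adjoin_of abs_mult power_abs)
qed

lemma keys_adjoin: "keys c \<subseteq> Pow S \<Longrightarrow> keys (adjoin v c) \<subseteq> Pow (insert v S)"
  by (rule keys_image_subset[of c "Pow S"]) (auto simp: adjoin_of)

lemma keys_adjoin_list: "keys c \<subseteq> Pow S \<Longrightarrow> keys (adjoin_list vs c) \<subseteq> Pow (set vs \<union> S)"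
proof (induction vs)
  case (Cons v vs)
  then show ?case
    using keys_adjoin[of "adjoin_list vs c" "set vs \<union> S" v] by simp
qed simp

lemma keys_contract_list_of:
  "keys (contract_list vs (frag_of \<sigma>)) \<subseteq> {\<tau>. \<tau> = \<sigma> - set vs \<and> set vs \<subseteq> \<sigma>}"
proof (induction vs arbitrary: \<sigma>)
  case (Cons v vs)
  have "keys (contract_list vs (frag_of (\<sigma> - {v}))) \<subseteq> {\<tau>. \<tau> = \<sigma> - set (v # vs) \<and> set (v # vs) \<subseteq> \<sigma>}" if "v \<in> \<sigma>"
    using Cons[of "\<sigma> - {v}"] that by auto
  moreover have "contract_list vs 0 = (0 :: 'a set \<Rightarrow>\<^sub>0 int)"
    using contract_list_diff[of vs 0 0] by simp
  ultimately show ?case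
    by (auto simp: contract_of)
qed auto

lemma keys_residue_of:
  "keys (residue S vs (frag_of \<sigma>)) \<subseteq> {\<tau>. \<tau> = \<sigma> - set vs \<and> set vs \<subseteq> \<sigma> \<and> \<tau> \<inter> S = {}}"
  unfolding residue_def
proof (rule keys_image_subset[where f = "avoid S", OF keys_contract_list_of[of vs \<sigma>]])
  fix \<tau> assume "\<tau> \<in> {\<tau>. \<tau> = \<sigma> - set vs \<and> set vs \<subseteq> \<sigma>}"
  then show "keys (avoid S (frag_of \<tau>)) \<subseteq> {\<tau>. \<tau> = \<sigma> - set vs \<and> set vs \<subseteq> \<sigma> \<and> \<tau> \<inter> S = {}}"
    by (cases "\<tau> \<inter> S = {}") (simp_all add: avoid_of)
qed simp

lemma keys_residue:
  "keys (residue S vs c) \<subseteq> {\<tau>. \<exists>\<sigma>\<in>keys c. \<tau> = \<sigma> - set vs \<and> set vs \<subseteq> \<sigma> \<and> \<tau> \<inter> S = {}}"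
proof (rule keys_image_subset[of c "keys c" "residue S vs"])
  fix \<sigma> assume \<sigma>: "\<sigma> \<in> keys c"
  show "keys (residue S vs (frag_of \<sigma>))
      \<subseteq> {\<tau>. \<exists>\<sigma>\<in>keys c. \<tau> = \<sigma> - set vs \<and> set vs \<subseteq> \<sigma> \<and> \<tau> \<inter> S = {}}"
    by (rule order_trans[OF keys_residue_of], rule Collect_mono) (use \<sigma> in blast)
qed simp_all

lemma residue_eq_0: "keys c \<subseteq> {\<sigma>. \<not> set vs \<subseteq> \<sigma>} \<Longrightarrow> residue S vs c = 0"
  using keys_residue[of S vs c] by (subst keys_eq_empty[symmetric]) blast

section \<open>Boundaries of residues and of adjunctions\<close>

lemma boundary_on_disjoint:
  assumes "keys c \<subseteq> Pow S" "S \<inter> T = {}"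
  shows "boundary_on T c = 0"
  unfolding boundary_on_def
proof (rule sum.neutral, rule ballI)
  fix v assume "v \<in> T"
  show "contract v c = 0"
    by (rule frag_eqI[of c, OF assms(1)]) (use assms(2) \<open>v \<in> T\<close> in \<open>auto simp: contract_of\<close>)
qed

lemma boundary_on_insert:
  assumes "finite S" "v \<notin> S"
  shows "boundary_on (insert v S) c = contract v c + boundary_on S c"
  using assms by (simp add: boundary_on_def)

lemma boundary_on_contract_list:
  "boundary_on S (contract_list vs c) = frag_cmul ((-1) ^ length vs) (contract_list vs (boundary_on S c))"
proof (induction vs arbitrary: c)
  case (Cons v vs)
  have *: "boundary_on S (contract v c) = frag_cmul (-1) (contract v (boundary_on S c))"
    by (simp add: contract_boundary_on)
  show ?case
    by (simp only: contract_list.simps Cons * contract_list_cmul frag_cmul_cmul length_Cons power_Suc2)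
qed simp

lemma contract_contract_list:
  "contract v (contract_list vs c) = frag_cmul ((-1) ^ length vs) (contract_list vs (contract v c))"
  using boundary_on_contract_list[of "{v}"] by (simp add: boundary_on_def)

text \<open>\<open>boundary_on S\<close> never deletes \<open>v\<close>, so faces through
  \<open>v\<close> contribute to neither side; on the other faces it is the full boundary.\<close>

lemma avoid_boundary_on:
  assumes "finite S" "keys c \<subseteq> Pow (insert v S)" "v \<in> T" "S \<inter> T = {}"
  shows "avoid T (boundary_on S c) = boundary_map (avoid T c)"
proof (rule frag_eqI[of c, OF assms(2)])
  fix \<sigma> assume \<sigma>: "\<sigma> \<in> Pow (insert v S)"
  show "avoid T (boundary_on S (frag_of \<sigma>)) = boundary_map (avoid T (frag_of \<sigma>))"
  proof (cases "v \<in> \<sigma>")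
    case True
    have "keys (boundary_on S (frag_of \<sigma>)) \<subseteq> {\<tau>. v \<in> \<tau>}"
      using keys_boundary_on_of[of S \<sigma>] True assms(3,4) by blast
    then have "avoid T (boundary_on S (frag_of \<sigma>)) = 0"
      unfolding avoid_def by (intro frag_extend_eq_0) (use assms(3) in auto)
    then show ?thesis
      using True assms(3) by (auto simp: avoid_of)
  next
    case False
    then have \<sigma>S: "\<sigma> \<subseteq> S"
      using \<sigma> by auto
    then have "keys (boundary_on S (frag_of \<sigma>)) \<subseteq> Pow S"
      using keys_boundary_on_of[of S \<sigma>] by blast
    then have "avoid T (boundary_on S (frag_of \<sigma>)) = frag_extend frag_of (boundary_on S (frag_of \<sigma>))"
      unfolding avoid_def by (intro frag_extend_eq) (use assms(4) in auto)
    also have "\<dots> = boundary_map (frag_of \<sigma>)"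
      using \<sigma>S by (simp add: frag_expansion[symmetric] boundary_map_eq_boundary_on[OF assms(1)])
    finally show ?thesis
      using \<sigma>S assms(4) by (auto simp: avoid_of)
  qed
qed simp_all

text \<open>Sort the boundary terms by the deleted vertex. Vertices of \<open>S\<close> give the
  boundary of the residue, with one sign for each contraction passed; vertices of \<open>vs\<close>
  give nothing, since the residue asks for all of \<open>vs\<close>; deleting \<open>v\<close> gives
  the next residue.\<close>

lemma residue_boundary:
  assumes "finite S" "S \<inter> T = {}" "v \<in> T" "v \<notin> set vs"
    and c: "keys c \<subseteq> Pow (insert v (set vs \<union> S))"
  shows "residue T vs (boundary_map c) =
    frag_cmul ((-1) ^ length vs) (boundary_map (residue T vs c)) + residue T (v # vs) c"
proof -
  let ?S = "insert v (set vs \<union> S)"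
  let ?d = "contract_list vs c"
  have v: "v \<notin> S"
    using assms(2,3) by auto
  have "keys ?d \<subseteq> Pow (insert v S)"
  proof (rule keys_image_subset[of c, OF c])
    fix \<sigma> assume "\<sigma> \<in> Pow ?S"
    then show "keys (contract_list vs (frag_of \<sigma>)) \<subseteq> Pow (insert v S)"
      using keys_contract_list_of[of vs \<sigma>] by blast
  qed simp
  note d = this
  have d': "keys ?d \<subseteq> Pow ?S"
    by (rule order_trans[OF d]) auto
  \<comment> \<open>The contraction has removed \<open>vs\<close> from all faces, so both sides
    equal the full boundary.\<close>
  have "boundary_on ?S ?d = boundary_on (insert v S) ?d"
    using boundary_map_eq_boundary_on[OF _ d'] boundary_map_eq_boundary_on[OF _ d] assms(1) by simp
  also have "\<dots> = frag_cmul ((-1) ^ length vs) (contract_list (v # vs) c) + boundary_on S ?d"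
    by (simp add: boundary_on_insert[OF assms(1) v] contract_contract_list)
  finally have bd: "boundary_on ?S ?d = frag_cmul ((-1) ^ length vs) (contract_list (v # vs) c) + boundary_on S ?d" .
  have "contract_list vs (boundary_on ?S c) = frag_cmul ((-1) ^ length vs) (boundary_on ?S ?d)"
    by (simp add: boundary_on_contract_list)
  also have "\<dots> = contract_list (v # vs) c + frag_cmul ((-1) ^ length vs) (boundary_on S ?d)"
    unfolding bd by (simp add: frag_cmul_distrib2)
  finally have "residue T vs (boundary_on ?S c) =
      residue T (v # vs) c + frag_cmul ((-1) ^ length vs) (avoid T (boundary_on S ?d))"
    by (simp add: residue_def avoid_add)
  also have "avoid T (boundary_on S ?d) = boundary_map (residue T vs c)"
    unfolding residue_def by (rule avoid_boundary_on) fact+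
  finally show ?thesis
    using assms(1) by (simp add: boundary_map_eq_boundary_on[OF _ c] add.commute)
qed

lemma boundary_map_adjoin:
  assumes "finite S" "keys c \<subseteq> Pow S"
  shows "boundary_map (adjoin v c) = c - adjoin v (boundary_map c)"
proof -
  have "keys c \<subseteq> {\<sigma>. finite \<sigma>}" "keys c \<subseteq> Pow (insert v S)"
    using assms by (auto dest: finite_subset)
  then show ?thesis
    using boundary_on_adjoin[of "insert v S" c v] keys_adjoin[OF assms(2), of v] assms(1)
    by (simp add: boundary_map_eq_boundary_on[of "insert v S"])
qed

text \<open>The Leibniz rule modulo terms in which a vertex of \<open>vs\<close> is deleted.
  Residues along \<open>vs\<close> annihilate these, so only their support matters.\<close>

lemma keys_boundary_adjoin_list:
  assumes "finite S" "keys c \<subseteq> Pow S" "distinct vs" "set vs \<inter> S = {}"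
  shows "keys (boundary_map (adjoin_list vs c) - frag_cmul ((-1) ^ length vs) (adjoin_list vs (boundary_map c)))
    \<subseteq> {\<sigma>. \<not> set vs \<subseteq> \<sigma>}"
  using assms(3,4)
proof (induction vs)
  case (Cons v vs)
  let ?E = "adjoin_list vs c"
  let ?d = "boundary_map ?E - frag_cmul ((-1) ^ length vs) (adjoin_list vs (boundary_map c))"
  have E: "keys ?E \<subseteq> Pow (set vs \<union> S)"
    by (rule keys_adjoin_list[OF assms(2)])
  have v: "v \<notin> set vs" "v \<notin> S"
    using Cons.prems by auto
  have "keys ?d \<subseteq> {\<sigma>. \<not> set vs \<subseteq> \<sigma>}"
    using Cons by simp
  then have "keys (adjoin v ?d) \<subseteq> {\<sigma>. \<not> set vs \<subseteq> \<sigma>}"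
    by (rule keys_image_subset[of ?d _ "adjoin v"]) (use v in \<open>auto simp: adjoin_of\<close>)
  \<comment> \<open>The term in which \<open>v\<close> is deleted is \<open>?E\<close>, whose faces
    miss \<open>v\<close>; the rest is the induction hypothesis with \<open>v\<close>
    adjoined.\<close>
  moreover have "boundary_map (adjoin_list (v # vs) c)
      - frag_cmul ((-1) ^ length (v # vs)) (adjoin_list (v # vs) (boundary_map c)) = ?E - adjoin v ?d"
    using boundary_map_adjoin[of "set vs \<union> S", OF _ E, of v] assms(1)
    by (simp flip: minus_frag_cmul)
  ultimately show ?case
    using keys_diff[of ?E "adjoin v ?d"] E v by auto
qed simp

section \<open>Fillers of the transversal cycles\<close>

lemma frag_extend_plus: "frag_extend (\<lambda>x. f x + g x) c = frag_extend f c + frag_extend g c"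
  by (simp add: frag_extend_def frag_cmul_distrib2 sum.distrib)

lemma frag_cmul_uminus [simp]: "frag_cmul k (- c) = frag_cmul (- k) c"
  by (simp flip: frag_cmul_minus_one)

lemma frag_extend_cmul_fun: "frag_extend (\<lambda>x. frag_cmul k (f x)) c = frag_cmul k (frag_extend f c)"
  by (simp add: frag_extend_def frag_cmul_sum mult.commute)

context coloured_vertices
begin

text \<open>Vanishing on inadmissible sets is part of the notion because such sets occur in the
  boundary of an admissible one.\<close>

definition filler :: "'a set set \<Rightarrow> ('a set \<Rightarrow> ('a set \<Rightarrow>\<^sub>0 int)) \<Rightarrow> bool" where
  "filler X \<phi> \<longleftrightarrow>
     (\<forall>A. admissible A \<longrightarrow> keys (\<phi> A) \<subseteq> {\<sigma> \<in> X. \<sigma> \<subseteq> A \<and> card \<sigma> + length is = card A + 1}) \<and>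
     (\<forall>A. \<not> admissible A \<longrightarrow> \<phi> A = 0) \<and>
     (\<forall>A. admissible A \<longrightarrow> boundary_map (\<phi> A) = frag_extend \<phi> (boundary_map (frag_of A)) + transversal_cycle A)"

lemma fillerD:
  assumes "filler X \<phi>"
  shows filler_keys: "admissible A \<Longrightarrow> keys (\<phi> A) \<subseteq> {\<sigma> \<in> X. \<sigma> \<subseteq> A \<and> card \<sigma> + length is = card A + 1}"
    and filler_zero: "\<not> admissible A \<Longrightarrow> \<phi> A = 0"
    and filler_boundary: "admissible A \<Longrightarrow>
      boundary_map (\<phi> A) = frag_extend \<phi> (boundary_map (frag_of A)) + transversal_cycle A"
  by (erule assms[unfolded filler_def, THEN conjunct1, rule_format]
      assms[unfolded filler_def, THEN conjunct2, THEN conjunct1, rule_format]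
      assms[unfolded filler_def, THEN conjunct2, THEN conjunct2, rule_format])+

lemma admissible_finite_subset: "A \<subseteq> U \<Longrightarrow> finite A"
  using finite_U finite_subset by blast

lemma fillerI_null_homotopy:
  assumes supp: "\<And>A. admissible A \<Longrightarrow> keys (h A) \<subseteq> {\<sigma> \<in> X. \<sigma> \<subseteq> A \<and> card \<sigma> + length is = card A + 1}"
    and zero: "\<And>A. \<not> admissible A \<Longrightarrow> h A = 0"
    and bd: "\<And>A. admissible A \<Longrightarrow>
      boundary_map (h A) + frag_extend h (boundary_map (frag_of A)) = transversal_cycle A"
  shows "\<exists>\<phi>. filler X \<phi>"
proof
  \<comment> \<open>The twist turns \<open>\<partial>h + h\<partial>\<close> into \<open>\<partial>\<phi> - \<phi>\<partial>\<close>; it does not affect the cycles, as these have even \<open>card A\<close>.\<close>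
  define \<phi> where "\<phi> A = frag_cmul ((-1) ^ card A) (h A)" for A
  show "filler X \<phi>"
    unfolding filler_def
  proof (intro conjI allI impI)
    fix A assume "admissible A"
    then show "keys (\<phi> A) \<subseteq> {\<sigma> \<in> X. \<sigma> \<subseteq> A \<and> card \<sigma> + length is = card A + 1}"
      unfolding \<phi>_def by (intro order_trans[OF keys_cmul] supp)
  next
    fix A assume "\<not> admissible A"
    then show "\<phi> A = 0"
      by (simp add: \<phi>_def zero)
  next
    fix A assume A: "admissible A"
    let ?k = "(-1) ^ card A :: int" and ?b = "boundary_map (frag_of A)"
    have "frag_extend \<phi> ?b = frag_extend (\<lambda>B. frag_cmul (- ?k) (h B)) ?b"
    proof (rule frag_extend_eq)
      fix B assume "B \<in> keys ?b"
      then obtain v where "B = A - {v}" "v \<in> A"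
        using subsetD[OF keys_boundary_map_of[OF admissible_finite[OF A]]] by blast
      then have "card A = Suc (card B)"
        using card_Suc_Diff1[OF admissible_finite[OF A]] by simp
      then show "\<phi> B = frag_cmul (- ?k) (h B)"
        by (simp add: \<phi>_def)
    qed
    then have 1: "frag_extend \<phi> ?b = - frag_cmul ?k (frag_extend h ?b)"
      by (simp add: frag_extend_cmul_fun)
    have 2: "boundary_map (\<phi> A) = frag_cmul ?k (boundary_map (h A))"
      by (simp add: \<phi>_def boundary_map_def frag_extend_cmul)
    have "frag_cmul ?k (transversal_cycle A) = transversal_cycle A"
      using multicoloured_card[of 2 A] by (cases "multicoloured 2 A") (simp_all add: transversal_cycle_def)
    then have 3: "transversal_cycle A = frag_cmul ?k (boundary_map (h A)) + frag_cmul ?k (frag_extend h ?b)"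
      unfolding bd[OF A, symmetric] frag_cmul_distrib2 by simp
    show "boundary_map (\<phi> A) = frag_extend \<phi> ?b + transversal_cycle A"
      unfolding 1 2 3 by (simp del: minus_frag_cmul)
  qed
qed

lemma card_admissible_less: "admissible A \<Longrightarrow> card A < card U + 1"
  using card_mono[OF finite_U, of A] by (simp add: admissible_def)

text \<open>\<open>transversal_cycle\<close> is a chain map, as its composites with the boundary on
  both sides are \<open>0\<close>. It lowers \<open>card\<close> by the number of colours, and
  admissible sets have at least twice that many vertices, so its values lie in the acyclic
  range.\<close>

lemma filler_exists:
  assumes "acyclic_from X (length is)" and "\<And>\<sigma>. multicoloured 1 \<sigma> \<Longrightarrow> \<sigma> \<in> X"
  shows "\<exists>\<phi>. filler X \<phi>"
proof -
  have supp: "keys (transversal_cycle A) \<subseteq> {\<sigma> \<in> X. \<sigma> \<subseteq> A \<and> card \<sigma> + length is = card A}" for A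
    by (rule order_trans[OF keys_transversal_cycle]) (use assms(2) in auto)
  obtain h where h:
    "\<And>A. admissible A \<Longrightarrow> keys (h A) \<subseteq> {\<sigma> \<in> X. \<sigma> \<subseteq> A \<and> card \<sigma> + length is = card A + 1}"
    "\<And>A. \<not> admissible A \<Longrightarrow> h A = 0"
    "\<And>A. admissible A \<Longrightarrow> boundary_map (h A) + frag_extend h (boundary_map (frag_of A)) = transversal_cycle A"
  proof (rule null_homotopy[OF admissible_finite admissible_convex assms(1) _ supp])
    show "length is + length is \<le> card A" if "admissible A" for A
      using admissible_card[OF that] by simp
    show "transversal_cycle A = 0" if "\<not> admissible A" for A
      using that multicoloured_imp_admissible by (auto simp: transversal_cycle_def)
    show "boundary_map (transversal_cycle A) = frag_extend transversal_cycle (boundary_map (frag_of A))"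
      if "admissible A" for A
      using that by (simp add: boundary_transversal_cycle transversal_cycle_boundary admissible_def)
  qed (use card_admissible_less in auto)
  then show ?thesis
    by (rule fillerI_null_homotopy)
qed

text \<open>Subsets of an inadmissible set in \<open>U\<close> are inadmissible, so there every term
  is \<open>0\<close>, and the filler equation extends to all chains on \<open>U\<close>.\<close>

lemma boundary_filler:
  assumes "filler X \<phi>" "keys c \<subseteq> Pow U"
  shows "boundary_map (frag_extend \<phi> c) = frag_extend \<phi> (boundary_map c) + frag_extend transversal_cycle c"
proof (rule frag_eqI[of c, OF assms(2)])
  fix A assume "A \<in> Pow U"
  then have A: "A \<subseteq> U" "finite A"
    using admissible_finite_subset by auto
  show "boundary_map (frag_extend \<phi> (frag_of A)) =
      frag_extend \<phi> (boundary_map (frag_of A)) + frag_extend transversal_cycle (frag_of A)"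
  proof (cases "admissible A")
    case True
    then show ?thesis
      using filler_boundary[OF assms(1)] by simp
  next
    case False
    have "\<phi> B = 0" if "B \<in> keys (boundary_map (frag_of A))" for B
    proof -
      have "B \<subseteq> A"
        using subsetD[OF keys_boundary_map_of[OF A(2)] that] by auto
      then have "\<not> admissible B"
        using False admissible_mono A(1) by blast
      then show ?thesis
        by (rule filler_zero[OF assms(1)])
    qed
    then have "frag_extend \<phi> (boundary_map (frag_of A)) = 0"
      by (rule frag_extend_eq_0)
    moreover have "transversal_cycle A = 0" "\<phi> A = 0"
      using False multicoloured_imp_admissible filler_zero[OF assms(1)] by (auto simp: transversal_cycle_def)
    ultimately show ?thesis
      by simp
  qed
qed (simp_all add: frag_extend_diff)

end

text \<open>Without colours the empty set is admissible and its transversal cycle is the empty face,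
  but \<open>\<phi> {}\<close> would have to consist of one-vertex faces inside the empty
  set.\<close>

lemma not_filler_Nil: "\<not> coloured_vertices.filler V [] X \<phi>"
proof
  have coloured: "coloured_vertices V []"
    by (rule coloured_vertices.intro) (auto simp: disjoint_family_on_def)
  assume filler: "coloured_vertices.filler V [] X \<phi>"
  have adm: "coloured_vertices.admissible V [] {}"
    by (simp add: coloured_vertices.admissible_def[OF coloured])
  have "\<sigma> \<notin> keys (\<phi> {})" for \<sigma>
    using coloured_vertices.filler_keys[OF coloured filler adm] by force
  then have "keys (\<phi> {}) = {}"
    by blast
  then have "\<phi> {} = 0"
    by simp
  moreover have "boundary_map (frag_of {}) = (0 :: 'b set \<Rightarrow>\<^sub>0 int)"
    by (simp add: boundary_map_def simplex_boundary_def)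
  ultimately have "coloured_vertices.transversal_cycle V [] {} = 0"
    using coloured_vertices.filler_boundary[OF coloured filler adm] by simp
  then show False
    by (simp add: coloured_vertices.transversal_cycle_def[OF coloured] coloured_vertices.multicoloured_def[OF coloured])
qed

text \<open>Each operator passes \<open>v\<close> at the cost of one sign, as \<open>v\<close> has
  none of the colours. The support is treated in the same induction because
  \<open>boundary_on_adjoin\<close> requires finite faces.\<close>

lemma colour_boundary_adjoin:
  assumes "finite S" "keys c \<subseteq> Pow S" "\<And>i. i \<in> set is \<Longrightarrow> finite (V i) \<and> v \<notin> V i"
  shows "colour_boundary V is (adjoin v c) = frag_cmul ((-1) ^ length is) (adjoin v (colour_boundary V is c))"
    and "keys (colour_boundary V is c) \<subseteq> Pow S"
  using assms(3)
proof (induction "is")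
  case (Cons i "is")
  {
    case 1
    have "keys (colour_boundary V is c) \<subseteq> {\<sigma>. finite \<sigma>}"
      using Cons(2) 1 assms(1) by (auto dest: finite_subset)
    then show ?case
      using Cons(1) 1 by (simp add: boundary_on_cmul boundary_on_adjoin)
  next
    case 2
    have "keys (colour_boundary V is c) \<subseteq> Pow S"
      using Cons(2) 2 by auto
    then show ?case
      unfolding colour_boundary.simps
      by (rule keys_image_subset[of "colour_boundary V is c" _ "boundary_on (V i)"])
        (use keys_boundary_on_of in force)+
  }
qed (use assms(2) in simp_all)

section \<open>Removing a colour\<close>

lemma coloured_vertices_tail: "coloured_vertices V (i # is) \<Longrightarrow> coloured_vertices V is"
  by (auto simp: coloured_vertices_def disjoint_family_on_def)

locale colour_removal = coloured_vertices V "i # is"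
  for V :: "'i \<Rightarrow> 'a set" and i :: 'i and "is" :: "'i list" +
  fixes X :: "'a set set" and \<phi> :: "'a set \<Rightarrow> ('a set \<Rightarrow>\<^sub>0 int)"
  assumes filler: "filler X \<phi>"
    and down: "\<And>\<sigma> \<tau>. \<sigma> \<in> X \<Longrightarrow> \<tau> \<subseteq> \<sigma> \<Longrightarrow> \<tau> \<in> X"
begin

text \<open>Two colourings are in use at once: plain names refer to \<open>i # is\<close>, names
  with \<open>rest\<close> to \<open>is\<close>.\<close>

lemma rest_coloured: "coloured_vertices V is"
  by (rule coloured_vertices_tail[OF coloured_vertices_axioms])

abbreviation rest_U :: "'a set" where
  "rest_U \<equiv> (\<Union>i\<in>set is. V i)"

abbreviation rest_admissible :: "'a set \<Rightarrow> bool" where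
  "rest_admissible \<equiv> coloured_vertices.admissible V is"

abbreviation rest_multicoloured :: "nat \<Rightarrow> 'a set \<Rightarrow> bool" where
  "rest_multicoloured \<equiv> coloured_vertices.multicoloured V is"

abbreviation rest_transversal_cycle :: "'a set \<Rightarrow> ('a set \<Rightarrow>\<^sub>0 int)" where
  "rest_transversal_cycle \<equiv> coloured_vertices.transversal_cycle V is"

abbreviation rest_filler :: "'a set set \<Rightarrow> ('a set \<Rightarrow> ('a set \<Rightarrow>\<^sub>0 int)) \<Rightarrow> bool" where
  "rest_filler \<equiv> coloured_vertices.filler V is"

lemmas rest_admissible_card = coloured_vertices.admissible_card[OF rest_coloured]
lemmas rest_admissible_convex = coloured_vertices.admissible_convex[OF rest_coloured]
lemmas rest_admissible_def = coloured_vertices.admissible_def[OF rest_coloured]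
lemmas rest_admissible_finite = coloured_vertices.admissible_finite[OF rest_coloured]
lemmas rest_admissible_finite_subset = coloured_vertices.admissible_finite_subset[OF rest_coloured]
lemmas rest_boundary_transversal_cycle = coloured_vertices.boundary_transversal_cycle[OF rest_coloured]
lemmas rest_card_admissible_less = coloured_vertices.card_admissible_less[OF rest_coloured]
lemmas rest_fillerI_null_homotopy = coloured_vertices.fillerI_null_homotopy[OF rest_coloured]
lemmas rest_multicoloured_def = coloured_vertices.multicoloured_def[OF rest_coloured]
lemmas rest_transversal_cycle_boundary = coloured_vertices.transversal_cycle_boundary[OF rest_coloured]
lemmas rest_transversal_cycle_def = coloured_vertices.transversal_cycle_def[OF rest_coloured]

lemma finite_colour: "finite (V i)"
  by (simp add: fin)

lemma rest_disjoint: "rest_U \<inter> V i = {}"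
  using distinct disj by (auto simp: disjoint_family_on_def)

lemma rest_disjoint_colour: "j \<in> set is \<Longrightarrow> V j \<inter> V i = {}"
  using rest_disjoint by blast

lemma union_colours:
  assumes "S \<subseteq> V i" "A \<subseteq> rest_U"
  shows "S \<union> A \<subseteq> U" "(S \<union> A) \<inter> V i = S" "\<And>j. j \<in> set is \<Longrightarrow> (S \<union> A) \<inter> V j = A \<inter> V j"
  using assms rest_disjoint rest_disjoint_colour by auto

lemma admissible_union:
  assumes "S \<subseteq> V i" "A \<subseteq> rest_U"
  shows "admissible (S \<union> A) \<longleftrightarrow> 2 \<le> card S \<and> rest_admissible A"
  using union_colours[OF assms] assms(2) by (simp add: admissible_def rest_admissible_def)

lemma multicoloured_union:
  assumes "S \<subseteq> V i" "A \<subseteq> rest_U"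
  shows "multicoloured m (S \<union> A) \<longleftrightarrow> card S = m \<and> rest_multicoloured m A"
  using union_colours[OF assms] assms(2) by (simp add: multicoloured_def rest_multicoloured_def)

text \<open>With \<open>us\<close> listing the first \<open>k\<close> vertices of the colour and \<open>w\<close> the next one, \<open>slice us us\<close> is the
  \<open>k\<close>-th chain map and \<open>slice us (w # us)\<close> the homotopy to the next one.\<close>

definition slice :: "'a list \<Rightarrow> 'a list \<Rightarrow> ('a set \<Rightarrow>\<^sub>0 int) \<Rightarrow> ('a set \<Rightarrow>\<^sub>0 int)" where
  "slice us ws c = residue (V i) us (frag_extend \<phi> (adjoin_list ws c))"

lemma slice_diff [simp]: "slice us ws (a - b) = slice us ws a - slice us ws b"
  by (simp add: slice_def frag_extend_diff)

lemma adjoin_list_colour: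
  assumes "A \<subseteq> rest_U" "distinct ws" "set ws \<subseteq> V i"
  obtains k where "\<bar>k\<bar> = 1" "adjoin_list ws (frag_of A) = frag_cmul k (frag_of (set ws \<union> A))"
proof -
  have "set ws \<inter> A = {}"
    using assms rest_disjoint by blast
  then show ?thesis
    using adjoin_list_of[OF rest_admissible_finite_subset[OF assms(1)] assms(2)] that by blast
qed

lemma slice_zero:
  assumes "A \<subseteq> rest_U" "distinct ws" "set ws \<subseteq> V i" "\<not> (2 \<le> length ws \<and> rest_admissible A)"
  shows "slice us ws (frag_of A) = 0"
proof -
  obtain k where "adjoin_list ws (frag_of A) = frag_cmul k (frag_of (set ws \<union> A))"
    using adjoin_list_colour[OF assms(1-3)] by blast
  moreover have "\<phi> (set ws \<union> A) = 0"
    using admissible_union[OF assms(3,1)] assms(4) distinct_card[OF assms(2)]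
    by (intro filler_zero[OF filler]) simp
  ultimately show ?thesis
    by (simp add: slice_def frag_extend_cmul)
qed

text \<open>Faces of \<open>\<phi> (set ws \<union> A)\<close> have
  \<open>length ws + card A - length is\<close> vertices, and the residue takes away
  \<open>length us\<close> of them. So \<open>slice us us\<close> lowers \<open>card\<close> by
  \<open>length is\<close>, and \<open>slice us (w # us)\<close> by one less, as a homotopy
  should.\<close>

lemma keys_slice:
  assumes "A \<subseteq> rest_U" "distinct ws" "set ws \<subseteq> V i" "distinct us"
  shows "keys (slice us ws (frag_of A)) \<subseteq>
    {\<tau>. \<tau> \<union> set us \<in> X \<and> \<tau> \<inter> V i = {} \<and> \<tau> \<subseteq> A \<and> card \<tau> + length us + length is = card A + length ws}"
proof (cases "2 \<le> length ws \<and> rest_admissible A")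
  case True
  have finA: "finite A"
    by (rule rest_admissible_finite_subset[OF assms(1)])
  obtain k where k: "adjoin_list ws (frag_of A) = frag_cmul k (frag_of (set ws \<union> A))"
    using adjoin_list_colour[OF assms(1-3)] by blast
  have adm: "admissible (set ws \<union> A)"
    using admissible_union[OF assms(3,1)] True distinct_card[OF assms(2)] by simp
  have "set ws \<inter> A = {}"
    using assms rest_disjoint by blast
  then have card: "card (set ws \<union> A) = length ws + card A"
    using card_Un_disjoint[of "set ws" A] finA distinct_card[OF assms(2)] by simp
  show ?thesis
  proof
    fix \<tau> assume "\<tau> \<in> keys (slice us ws (frag_of A))"
    then obtain \<sigma> where \<sigma>: "\<sigma> \<in> keys (frag_extend \<phi> (adjoin_list ws (frag_of A)))"
      and \<tau>: "\<tau> = \<sigma> - set us" "set us \<subseteq> \<sigma>" "\<tau> \<inter> V i = {}"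
      unfolding slice_def using subsetD[OF keys_residue] by blast
    have "\<sigma> \<in> keys (\<phi> (set ws \<union> A))"
      using \<sigma> unfolding k frag_extend_cmul by (simp add: subsetD[OF keys_cmul])
    from subsetD[OF filler_keys[OF filler adm] this]
    have \<sigma>': "\<sigma> \<in> X" "\<sigma> \<subseteq> set ws \<union> A" "card \<sigma> + length (i # is) = card (set ws \<union> A) + 1"
      by auto
    have "finite \<sigma>"
      using \<sigma>'(2) finA finite_subset by auto
    then have "card \<sigma> = card \<tau> + length us"
      using card_Diff_subset[of "set us" \<sigma>] card_mono[of \<sigma> "set us"] \<tau> distinct_card[OF assms(4)] by simp
    moreover have "\<tau> \<union> set us = \<sigma>" "\<tau> \<subseteq> A"
      using \<tau> \<sigma>'(2) assms(3) by auto
    ultimately show "\<tau> \<in> {\<tau>. \<tau> \<union> set us \<in> X \<and> \<tau> \<inter> V i = {} \<and> \<tau> \<subseteq> A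
        \<and> card \<tau> + length us + length is = card A + length ws}"
      using \<sigma>' \<tau>(3) card by auto
  qed
next
  case False
  then show ?thesis
    using slice_zero[OF assms(1-3) False] by simp
qed

lemma keys_filler_subset:
  assumes "keys c \<subseteq> Pow S"
  shows "keys (frag_extend \<phi> c) \<subseteq> Pow S"
proof (rule keys_image_subset[of c, OF assms])
  fix A assume "A \<in> Pow S"
  then show "keys (frag_extend \<phi> (frag_of A)) \<subseteq> Pow S"
    using filler_keys[OF filler, of A] filler_zero[OF filler, of A] by (cases "admissible A") auto
qed (simp add: frag_extend_diff)

lemma residue_filler_zero:
  assumes "keys c \<subseteq> {\<sigma>. \<not> set us \<subseteq> \<sigma>}"
  shows "residue (V i) us (frag_extend \<phi> c) = 0"
proof (rule residue_eq_0, rule keys_image_subset[of c, OF assms])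
  fix A assume A: "A \<in> {\<sigma>. \<not> set us \<subseteq> \<sigma>}"
  then show "keys (frag_extend \<phi> (frag_of A)) \<subseteq> {\<sigma>. \<not> set us \<subseteq> \<sigma>}"
    using filler_keys[OF filler, of A] filler_zero[OF filler, of A] by (cases "admissible A") auto
qed (simp add: frag_extend_diff)

text \<open>Adjoin \<open>w # us\<close> to \<open>A\<close>, apply \<open>\<phi>\<close>, and
  compute the residue of the boundary twice. One way is \<open>residue_boundary\<close>. The other
  is the filler equation: deleting \<open>w\<close> gives \<open>slice us us\<close>, deleting a
  vertex of \<open>us\<close> gives residue \<open>0\<close>, and deleting a vertex of
  \<open>A\<close> gives the homotopy at the boundary of \<open>A\<close>.\<close>

lemma slice_identity:
  assumes A: "A \<subseteq> rest_U" and ws: "distinct (w # us)" "set (w # us) \<subseteq> V i"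
  shows "frag_cmul ((-1) ^ length us)
      (boundary_map (slice us (w # us) (frag_of A)) + slice us (w # us) (boundary_map (frag_of A)))
    = slice us us (frag_of A) - slice (w # us) (w # us) (frag_of A)
      + residue (V i) us (frag_extend transversal_cycle (adjoin_list (w # us) (frag_of A)))"
proof -
  let ?E = "\<lambda>us. adjoin_list us (frag_of A)" and ?s = "(-1) ^ length us :: int"
  let ?b = "boundary_map (frag_of A)"
  let ?R = "residue (V i) us" and ?\<Phi> = "frag_extend \<phi>"
  have finA: "finite A" and disjA: "A \<inter> V i = {}"
    using rest_admissible_finite_subset[OF A] rest_disjoint A by auto
  have E: "keys (?E (w # us)) \<subseteq> Pow (set (w # us) \<union> A)" "keys (?E us) \<subseteq> Pow (set us \<union> A)"
    by (rule keys_adjoin_list, simp)+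
  have "set (w # us) \<union> A \<subseteq> U"
    by (rule union_colours(1)[OF ws(2) A])
  then have EU: "keys (?E (w # us)) \<subseteq> Pow U"
    using E(1) by (blast intro: order_trans)
  \<comment> \<open>The part of the boundary in which a vertex of \<open>us\<close> is
    deleted.\<close>
  define d where "d = boundary_map (?E us) - frag_cmul ?s (adjoin_list us ?b)"
  have d: "keys d \<subseteq> {\<sigma>. \<not> set us \<subseteq> \<sigma>}"
    unfolding d_def using keys_boundary_adjoin_list[of A "frag_of A" us] finA disjA ws by auto
  have wd: "keys (adjoin w d) \<subseteq> {\<sigma>. \<not> set us \<subseteq> \<sigma>}"
    by (rule keys_image_subset[of d _ "adjoin w", OF d]) (use ws(1) in \<open>auto simp: adjoin_of\<close>)
  have "boundary_map (?E (w # us)) = ?E us - adjoin w (boundary_map (?E us))"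
    using boundary_map_adjoin[OF _ E(2), of w] finA by simp
  also have "boundary_map (?E us) = d + frag_cmul ?s (adjoin_list us ?b)"
    by (simp add: d_def)
  finally have 1: "boundary_map (?E (w # us)) = ?E us - adjoin w d - frag_cmul ?s (adjoin_list (w # us) ?b)"
    by (simp add: adjoin_def frag_extend_add frag_extend_cmul)
  have "frag_cmul ?s (boundary_map (slice us (w # us) (frag_of A))) + slice (w # us) (w # us) (frag_of A)
      = ?R (boundary_map (?\<Phi> (?E (w # us))))"
    unfolding slice_def
    by (rule residue_boundary[symmetric, OF finA disjA])
      (use ws keys_filler_subset[OF E(1)] in auto)
  also have "\<dots> = ?R (?\<Phi> (boundary_map (?E (w # us)))) + ?R (frag_extend transversal_cycle (?E (w # us)))"
    by (simp only: boundary_filler[OF filler EU] residue_add)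
  also have "?R (?\<Phi> (boundary_map (?E (w # us)))) = slice us us (frag_of A) - frag_cmul ?s (slice us (w # us) ?b)"
    unfolding 1 by (simp add: frag_extend_diff frag_extend_cmul residue_filler_zero[OF wd] slice_def del: adjoin_list.simps)
  finally show ?thesis
    by (simp add: frag_cmul_distrib2 algebra_simps del: minus_frag_cmul)
qed

text \<open>The cycle is \<open>v\<close> adjoined to the cycle of the remaining colours, minus
  \<open>w\<close> adjoined to it; contracting \<open>v\<close> leaves the remaining cycle without a
  sign.\<close>

lemma residue_transversal_pair:
  assumes A: "A \<subseteq> rest_U" and vw: "v \<in> V i" "w \<in> V i" "v \<noteq> w"
  shows "residue (V i) [v] (frag_extend transversal_cycle (adjoin_list [w, v] (frag_of A))) = rest_transversal_cycle A"
proof -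
  let ?E = "adjoin_list [w, v] (frag_of A)"
  have finA: "finite A" and disjA: "A \<inter> V i = {}"
    using rest_admissible_finite_subset[OF A] rest_disjoint A by auto
  obtain k where k: "?E = frag_cmul k (frag_of ({w, v} \<union> A))"
    using adjoin_list_colour[OF A, of "[w, v]"] vw by auto
  have mc: "multicoloured 2 ({w, v} \<union> A) \<longleftrightarrow> rest_multicoloured 2 A"
    using multicoloured_union[of "{w, v}" A 2] vw A by simp
  show ?thesis
  proof (cases "rest_multicoloured 2 A")
    case False
    then have "transversal_cycle ({w, v} \<union> A) = 0" "rest_transversal_cycle A = 0"
      using mc by (simp_all add: transversal_cycle_def rest_transversal_cycle_def del: Un_insert_left)
    then show ?thesis
      unfolding k frag_extend_cmul by (simp del: Un_insert_left)
  next
    case True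
    let ?x = "colour_boundary V is (frag_of A)"
    have rest_v: "finite (V j) \<and> u \<notin> V j" if "j \<in> set is" "u \<in> V i" for j u
      using fin that rest_disjoint_colour by auto
    have x: "keys ?x \<subseteq> Pow A"
      by (rule colour_boundary_adjoin(2)[OF finA, where v = v]) (use rest_v vw in auto)
    have vx: "keys (adjoin v ?x) \<subseteq> Pow (insert v A)"
      by (rule keys_adjoin[OF x])
    \<comment> \<open>Passing \<open>w\<close> and passing \<open>v\<close> produce equal signs,
      which cancel.\<close>
    have "colour_boundary V is ?E = adjoin w (adjoin v ?x)"
      using colour_boundary_adjoin(1)[of "insert v A" "adjoin v (frag_of A)" "is" V w]
        colour_boundary_adjoin(1)[of A "frag_of A" "is" V v] keys_adjoin[of "frag_of A" A v]
        finA rest_v vw by simp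
    moreover have "frag_extend transversal_cycle ?E = colour_boundary V (i # is) ?E"
      unfolding k frag_extend_cmul colour_boundary_cmul
      using True mc by (simp add: transversal_cycle_def del: Un_insert_left)
    ultimately have "frag_extend transversal_cycle ?E = boundary_on (V i) (adjoin w (adjoin v ?x))"
      by simp
    also have "\<dots> = adjoin v ?x - adjoin w ?x"
    proof -
      have "keys ?x \<subseteq> {\<sigma>. finite \<sigma>}" "keys (adjoin v ?x) \<subseteq> {\<sigma>. finite \<sigma>}"
        using x vx finA by (auto dest: finite_subset)
      moreover have "boundary_on (V i) ?x = 0"
        by (rule boundary_on_disjoint[OF x disjA])
      ultimately show ?thesis
        using vw finite_colour by (simp add: boundary_on_adjoin)
    qed
    finally have M: "frag_extend transversal_cycle ?E = adjoin v ?x - adjoin w ?x" .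
    have "contract v ?x = 0"
      using boundary_on_disjoint[OF x, of "{v}"] disjA vw by (auto simp: boundary_on_def)
    moreover have "keys ?x \<subseteq> {\<sigma>. finite \<sigma>}"
      using x finA by (auto dest: finite_subset)
    ultimately have "contract v (frag_extend transversal_cycle ?E) = ?x"
      unfolding M using vw contract_adjoin_self[of ?x v] contract_adjoin[of v w ?x] by simp
    moreover have "avoid (V i) ?x = ?x"
    proof -
      have "avoid (V i) ?x = frag_extend frag_of ?x"
        unfolding avoid_def by (rule frag_extend_eq) (use x disjA in auto)
      then show ?thesis
        by (simp flip: frag_expansion)
    qed
    ultimately show ?thesis
      using True by (simp add: residue_def rest_transversal_cycle_def)
  qed
qed

lemma residue_transversal_zero:
  assumes "A \<subseteq> rest_U" "distinct ws" "set ws \<subseteq> V i" "3 \<le> length ws"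
  shows "frag_extend transversal_cycle (adjoin_list ws (frag_of A)) = 0"
proof -
  obtain k where "adjoin_list ws (frag_of A) = frag_cmul k (frag_of (set ws \<union> A))"
    using adjoin_list_colour[OF assms(1-3)] by blast
  moreover have "\<not> multicoloured 2 (set ws \<union> A)"
    using multicoloured_union[OF assms(3,1)] assms(4) distinct_card[OF assms(2)] by simp
  ultimately show ?thesis
    by (simp add: frag_extend_cmul transversal_cycle_def)
qed

end

lemma boundary_map_cmul: "boundary_map (frag_cmul k c) = frag_cmul k (boundary_map c)"
  by (simp add: boundary_map_def frag_extend_cmul)

section \<open>Telescoping the homotopies and removing the colour\<close>

context colour_removal
begin

text \<open>The form required by \<open>null_homotopy\<close>: a function of sets that is
  \<open>0\<close> on inadmissible ones.\<close>

definition slice_at :: "'a list \<Rightarrow> 'a list \<Rightarrow> 'a set \<Rightarrow> ('a set \<Rightarrow>\<^sub>0 int)" where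
  "slice_at us ws A = (if rest_admissible A then slice us ws (frag_of A) else 0)"

lemma slice_at_eq:
  assumes "distinct ws" "set ws \<subseteq> V i" "A \<subseteq> rest_U"
  shows "slice us ws (frag_of A) = slice_at us ws A"
  using slice_zero[OF assms(3,1,2)] by (simp add: slice_at_def)

lemma slice_eq_extend:
  assumes "distinct ws" "set ws \<subseteq> V i" "keys c \<subseteq> Pow rest_U"
  shows "slice us ws c = frag_extend (slice_at us ws) c"
  by (rule frag_eqI[of c, OF assms(3)]) (simp_all add: slice_at_eq[OF assms(1,2)] frag_extend_diff)

lemma boundary_keys_rest:
  assumes "A \<subseteq> rest_U"
  shows "keys (boundary_map (frag_of A)) \<subseteq> Pow rest_U"
  using keys_boundary_map_of[OF rest_admissible_finite_subset[OF assms]] assms by fastforce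

text \<open>The vertices are listed backwards, as each new one is put in front: \<open>v\<close> is
  the first, \<open>w\<close> the second. The equation covers all subsets of \<open>rest_U\<close>
  because it is also applied to facets of admissible sets.\<close>

lemma telescoped_homotopy:
  assumes us: "distinct (ws @ [w, v])" "set (ws @ [w, v]) \<subseteq> V i"
  shows "\<exists>F. (\<forall>A. rest_admissible A \<longrightarrow> keys (F A) \<subseteq> {\<sigma> \<in> X. \<sigma> \<subseteq> A \<and> card \<sigma> + length is = card A + 1})
    \<and> (\<forall>A. \<not> rest_admissible A \<longrightarrow> F A = 0)
    \<and> (\<forall>A. A \<subseteq> rest_U \<longrightarrow> boundary_map (F A) + frag_extend F (boundary_map (frag_of A))
        = rest_transversal_cycle A - slice_at (ws @ [w, v]) (ws @ [w, v]) A)"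
proof -
  let ?T = "\<lambda>A. {\<sigma> \<in> X. \<sigma> \<subseteq> A \<and> card \<sigma> + length is = card A + 1}"
  \<comment> \<open>The sign is the one in \<open>slice_identity\<close>.\<close>
  define G where "G us x A = frag_cmul ((-1) ^ length us) (slice_at us (x # us) A)" for us x A
  have G_keys: "keys (G us x A) \<subseteq> ?T A"
    if "rest_admissible A" "distinct (x # us)" "set (x # us) \<subseteq> V i" for us x A
  proof -
    have "A \<subseteq> rest_U"
      using that(1) by (simp add: rest_admissible_def)
    then have "keys (slice_at us (x # us) A) \<subseteq> {\<tau>. \<tau> \<union> set us \<in> X \<and> \<tau> \<inter> V i = {} \<and> \<tau> \<subseteq> A
        \<and> card \<tau> + length us + length is = card A + length (x # us)}"
      using keys_slice[of A "x # us" us] that by (simp add: slice_at_def)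
    \<comment> \<open>\<open>length us\<close> cancels and leaves a surplus of one vertex;
      \<open>down\<close> discards \<open>us\<close> from the face.\<close>
    also have "\<dots> \<subseteq> ?T A"
      by (auto intro: down)
    finally show ?thesis
      unfolding G_def by (rule order_trans[OF keys_cmul])
  qed
  have G_bd: "boundary_map (G us x A) + frag_extend (G us x) (boundary_map (frag_of A))
      = slice_at us us A - slice_at (x # us) (x # us) A
        + residue (V i) us (frag_extend transversal_cycle (adjoin_list (x # us) (frag_of A)))"
    if "A \<subseteq> rest_U" "distinct (x # us)" "set (x # us) \<subseteq> V i" for us x A
  proof -
    have us': "distinct us" "set us \<subseteq> V i"
      using that by auto
    have "boundary_map (G us x A) + frag_extend (G us x) (boundary_map (frag_of A))
        = frag_cmul ((-1) ^ length us) (boundary_map (slice us (x # us) (frag_of A))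
            + slice us (x # us) (boundary_map (frag_of A)))"
      unfolding G_def frag_extend_cmul_fun boundary_map_cmul frag_cmul_distrib2
        slice_at_eq[OF that(2,3,1)] slice_eq_extend[OF that(2,3) boundary_keys_rest[OF that(1)]] ..
    then show ?thesis
      using slice_identity[OF that] unfolding slice_at_eq[OF that(2,3,1)] slice_at_eq[OF us' that(1)] by simp
  qed
  from us show ?thesis
  proof (induction ws)
    case Nil
    then have *: "distinct [w, v]" "set [w, v] \<subseteq> V i" "v \<in> V i" "w \<in> V i" "v \<noteq> w"
      by auto
    \<comment> \<open>A single vertex of colour \<open>i\<close> is too few for admissibility, so
      the telescoping starts from \<open>0\<close>; the second vertex then brings in the transversal
      cycle.\<close>
    have v: "slice_at [v] [v] A = 0" if "A \<subseteq> rest_U" for A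
      using slice_zero[OF that, of "[v]"] * by (simp add: slice_at_def)
    show ?case
    proof (intro exI[of _ "G [v] w"] conjI allI impI)
      fix A assume "rest_admissible A"
      then show "keys (G [v] w A) \<subseteq> ?T A"
        by (rule G_keys) (use * in auto)
    next
      fix A assume "\<not> rest_admissible A"
      then show "G [v] w A = 0"
        by (simp add: G_def slice_at_def)
    next
      fix A assume A: "A \<subseteq> rest_U"
      show "boundary_map (G [v] w A) + frag_extend (G [v] w) (boundary_map (frag_of A))
          = rest_transversal_cycle A - slice_at ([] @ [w, v]) ([] @ [w, v]) A"
        unfolding G_bd[OF A *(1,2)] v[OF A] residue_transversal_pair[OF A *(3-5)] by simp
    qed
  next
    case (Cons x ws)
    let ?us = "ws @ [w, v]"
    have x: "distinct (x # ?us)" "set (x # ?us) \<subseteq> V i"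
      using Cons.prems by auto
    then obtain F where
      F_keys: "\<forall>A. rest_admissible A \<longrightarrow> keys (F A) \<subseteq> ?T A" and
      F_zero: "\<forall>A. \<not> rest_admissible A \<longrightarrow> F A = 0" and
      F_bd: "\<forall>A. A \<subseteq> rest_U \<longrightarrow> boundary_map (F A) + frag_extend F (boundary_map (frag_of A))
        = rest_transversal_cycle A - slice_at ?us ?us A"
      using Cons.IH by (auto elim!: exE conjE)
    show ?case
    proof (intro exI[of _ "\<lambda>A. F A + G ?us x A"] conjI allI impI)
      fix A assume "rest_admissible A"
      then have "keys (F A) \<subseteq> ?T A" "keys (G ?us x A) \<subseteq> ?T A"
        using F_keys G_keys[OF _ x] by blast+
      then show "keys (F A + G ?us x A) \<subseteq> ?T A"
        using keys_add[of "F A" "G ?us x A"] by blast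
    next
      fix A assume "\<not> rest_admissible A"
      then show "F A + G ?us x A = 0"
        using F_zero by (simp add: G_def slice_at_def)
    next
      fix A assume A: "A \<subseteq> rest_U"
      have "boundary_map (F A + G ?us x A) + frag_extend (\<lambda>A. F A + G ?us x A) (boundary_map (frag_of A))
          = (boundary_map (F A) + frag_extend F (boundary_map (frag_of A)))
            + (boundary_map (G ?us x A) + frag_extend (G ?us x) (boundary_map (frag_of A)))"
        by (simp add: boundary_map_add frag_extend_plus)
      \<comment> \<open>From the third vertex on there is no transversal term, and consecutive
        slices cancel.\<close>
      also have "\<dots> = rest_transversal_cycle A - slice_at ?us ?us A
          + (slice_at ?us ?us A - slice_at (x # ?us) (x # ?us) A)"
        unfolding G_bd[OF A x] F_bd[rule_format, OF A]
        using residue_transversal_zero[OF A x] by simp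
      finally show "boundary_map (F A + G ?us x A) + frag_extend (\<lambda>A. F A + G ?us x A) (boundary_map (frag_of A))
          = rest_transversal_cycle A - slice_at ((x # ws) @ [w, v]) ((x # ws) @ [w, v]) A"
        by simp
    qed
  qed
qed

text \<open>\<open>F\<close> bounds the remaining cycles up to the slice \<open>?c\<close> at the
  whole class, and a null homotopy \<open>h\<close> of \<open>?c\<close> in the link corrects the
  difference. The acyclic range suffices: \<open>?c\<close> lowers \<open>card\<close> by
  \<open>length is\<close>, on sets with at least \<open>2 * length is\<close> vertices.\<close>

lemma filler_rest:
  assumes "2 \<le> card (V i)"
    and acyclic: "V i \<in> X \<Longrightarrow> acyclic_from (link X (V i)) (length is)"
  shows "\<exists>\<psi>. rest_filler X \<psi>"
proof -
  let ?T = "\<lambda>A. {\<sigma> \<in> X. \<sigma> \<subseteq> A \<and> card \<sigma> + length is = card A + 1}"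
  obtain us where us: "set us = V i" "distinct us"
    using finite_distinct_list[OF finite_colour] by blast
  have "length us \<ge> 2"
    using assms(1) us distinct_card[OF us(2)] by simp
  then obtain vs v where vs: "us = vs @ [v]" "1 \<le> length vs"
    by (cases us rule: rev_cases) auto
  then obtain ws w where "vs = ws @ [w]"
    by (cases vs rule: rev_cases) auto
  with vs have wv: "us = ws @ [w, v]"
    by simp
  have us': "distinct (ws @ [w, v])" "set (ws @ [w, v]) \<subseteq> V i"
    using us unfolding wv by auto
  obtain F where
    F_keys: "\<forall>A. rest_admissible A \<longrightarrow> keys (F A) \<subseteq> ?T A" and
    F_zero: "\<forall>A. \<not> rest_admissible A \<longrightarrow> F A = 0" and
    F_bd: "\<forall>A. A \<subseteq> rest_U \<longrightarrow> boundary_map (F A) + frag_extend F (boundary_map (frag_of A))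
      = rest_transversal_cycle A - slice_at us us A"
    using telescoped_homotopy[OF us', folded wv] by (elim exE conjE)
  have restU: "A \<subseteq> rest_U" if "rest_admissible A" for A
    using that by (simp add: rest_admissible_def)
  let ?c = "slice_at us us"
  \<comment> \<open>As \<open>us\<close> exhausts \<open>V i\<close>, each face of the slice
    together with \<open>V i\<close> is a face of \<open>X\<close>. The set in
    \<open>c_keys'\<close> is empty or everything, so it encodes that a nonzero slice forces
    \<open>V i \<in> X\<close>.\<close>
  have c_keys: "keys (?c A) \<subseteq> {\<sigma> \<in> link X (V i). \<sigma> \<subseteq> A \<and> card \<sigma> + length is = card A}"
    and c_keys': "keys (?c A) \<subseteq> {\<sigma>. V i \<in> X}" if "rest_admissible A" for A
  proof -
    have *: "keys (?c A) \<subseteq> {\<tau>. \<tau> \<union> V i \<in> X \<and> \<tau> \<inter> V i = {} \<and> \<tau> \<subseteq> A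
        \<and> card \<tau> + length us + length is = card A + length us}"
      using keys_slice[of A us us] restU[OF that] that us by (simp add: slice_at_def)
    show "keys (?c A) \<subseteq> {\<sigma> \<in> link X (V i). \<sigma> \<subseteq> A \<and> card \<sigma> + length is = card A}"
      by (rule order_trans[OF *]) (auto simp: link_def intro: down)
    show "keys (?c A) \<subseteq> {\<sigma>. V i \<in> X}"
      by (rule order_trans[OF *]) (auto intro: down)
  qed
  have "\<exists>h. (\<forall>A. rest_admissible A \<longrightarrow> keys (h A) \<subseteq> ?T A) \<and> (\<forall>A. \<not> rest_admissible A \<longrightarrow> h A = 0)
    \<and> (\<forall>A. rest_admissible A \<longrightarrow> boundary_map (h A) + frag_extend h (boundary_map (frag_of A)) = ?c A)"
  proof (cases "V i \<in> X")
    case False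
    have "?c A = 0" for A
    proof (cases "rest_admissible A")
      case True
      then have "keys (?c A) = {}"
        using c_keys' False by simp
      then show ?thesis
        by simp
    qed (simp add: slice_at_def)
    then show ?thesis
      by (intro exI[of _ "\<lambda>_. 0"]) (simp add: frag_extend_eq_0)
  next
    case True
    \<comment> \<open>\<open>?c\<close> is the map of transversal cycles minus
      \<open>\<partial>F + F\<partial>\<close>; both commute with the boundary.\<close>
    have chain: "boundary_map (?c A) = frag_extend ?c (boundary_map (frag_of A))" if A: "rest_admissible A" for A
    proof -
      let ?b = "boundary_map (frag_of A)"
      have fA: "finite A"
        by (rule rest_admissible_finite[OF A])
      have bb: "boundary_map ?b = 0"
        using boundary_map_twice[OF fA, of "frag_of A"] by simp
      have "keys (F A) \<subseteq> Pow A"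
        using F_keys A by auto
      then have "boundary_map (boundary_map (F A)) = 0"
        by (rule boundary_map_twice[OF fA])
      then have "boundary_map (frag_extend F ?b) = - boundary_map (?c A)"
        using arg_cong[OF F_bd[rule_format, OF restU[OF A]], of boundary_map]
        by (simp add: boundary_map_add rest_boundary_transversal_cycle)
      moreover have "boundary_map (frag_extend F ?b) + frag_extend F (boundary_map ?b)
          = frag_extend rest_transversal_cycle ?b - frag_extend ?c ?b"
        by (rule frag_eqI[of ?b, OF boundary_keys_rest[OF restU[OF A]]])
          (use F_bd in \<open>auto simp: frag_extend_diff algebra_simps\<close>)
      ultimately show ?thesis
        using bb rest_transversal_cycle_boundary[OF restU[OF A]] by simp
    qed
    obtain h where h:
      "\<And>A. rest_admissible A \<Longrightarrow> keys (h A) \<subseteq> {\<sigma> \<in> link X (V i). \<sigma> \<subseteq> A \<and> card \<sigma> + length is = card A + 1}"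
      "\<And>A. \<not> rest_admissible A \<Longrightarrow> h A = 0"
      "\<And>A. rest_admissible A \<Longrightarrow> boundary_map (h A) + frag_extend h (boundary_map (frag_of A)) = ?c A"
    proof (rule null_homotopy[OF rest_admissible_finite rest_admissible_convex acyclic[OF True] _ c_keys _ chain])
      show "length is + length is \<le> card A" if "rest_admissible A" for A
        using rest_admissible_card[OF that] by simp
    qed (use rest_card_admissible_less in \<open>auto simp: slice_at_def\<close>)
    show ?thesis
    proof (intro exI[of _ h] conjI allI impI)
      fix A assume "rest_admissible A"
      then show "keys (h A) \<subseteq> ?T A"
        by (rule order_trans[OF h(1)]) (auto simp: link_def)
    qed (simp_all add: h)
  qed
  then obtain h where
    h_keys: "\<forall>A. rest_admissible A \<longrightarrow> keys (h A) \<subseteq> ?T A" and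
    h_zero: "\<forall>A. \<not> rest_admissible A \<longrightarrow> h A = 0" and
    h_bd: "\<forall>A. rest_admissible A \<longrightarrow> boundary_map (h A) + frag_extend h (boundary_map (frag_of A)) = ?c A"
    by (elim exE conjE)
  show ?thesis
  proof (rule rest_fillerI_null_homotopy[of "\<lambda>A. F A + h A"])
    fix A assume A: "rest_admissible A"
    show "keys (F A + h A) \<subseteq> ?T A"
      by (rule order_trans[OF keys_add]) (use F_keys h_keys A in simp)
    have "boundary_map (F A + h A) + frag_extend (\<lambda>A. F A + h A) (boundary_map (frag_of A))
        = (boundary_map (F A) + frag_extend F (boundary_map (frag_of A)))
          + (boundary_map (h A) + frag_extend h (boundary_map (frag_of A)))"
      by (simp add: boundary_map_add frag_extend_plus)
    also have "\<dots> = rest_transversal_cycle A"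
      unfolding F_bd[rule_format, OF restU[OF A]] h_bd[rule_format, OF A] by simp
    finally show "boundary_map (F A + h A) + frag_extend (\<lambda>A. F A + h A) (boundary_map (frag_of A))
        = rest_transversal_cycle A" .
  qed (use F_zero h_zero in simp)
qed

end

section \<open>Counting colours\<close>

lemma (in coloured_vertices) filler_mono:
  assumes "filler X \<phi>" "X \<subseteq> Y"
  shows "filler Y \<phi>"
  unfolding filler_def
proof (intro conjI allI impI)
  fix A assume "admissible A"
  then show "keys (\<phi> A) \<subseteq> {\<sigma> \<in> Y. \<sigma> \<subseteq> A \<and> card \<sigma> + length is = card A + 1}"
    by (rule order_trans[OF filler_keys[OF assms(1)]]) (use assms(2) in auto)
qed (use filler_zero[OF assms(1)] filler_boundary[OF assms(1)] in simp_all)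

lemma filler_tail:
  assumes "coloured_vertices V (i # is)" "coloured_vertices.filler V (i # is) X \<phi>"
    and "\<And>\<sigma> \<tau>. \<sigma> \<in> X \<Longrightarrow> \<tau> \<subseteq> \<sigma> \<Longrightarrow> \<tau> \<in> X"
    and "2 \<le> card (V i)" and "V i \<in> X \<Longrightarrow> acyclic_from (link X (V i)) (length is)"
  shows "\<exists>\<psi>. coloured_vertices.filler V is X \<psi>"
proof (rule colour_removal.filler_rest)
  show "colour_removal V i is X \<phi>"
    by (rule colour_removal.intro[OF assms(1)], rule colour_removal_axioms.intro[OF assms(2)], erule (1) assms(3))
qed (use assms(4,5) in auto)

text \<open>Colours are removed from the front. While those of \<open>fs\<close> go, at least
  \<open>length ns\<close> colours remain, which is where their links are acyclic; for
  \<open>ns\<close> the link condition is vacuous. The process ends in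
  \<open>not_filler_Nil\<close>.\<close>

lemma not_filler:
  assumes "coloured_vertices V (fs @ ns)"
    and down: "\<And>\<sigma> \<tau>. \<sigma> \<in> X \<Longrightarrow> \<tau> \<subseteq> \<sigma> \<Longrightarrow> \<tau> \<in> X"
    and "\<And>i. i \<in> set (fs @ ns) \<Longrightarrow> 2 \<le> card (V i)"
    and "\<And>i. i \<in> set fs \<Longrightarrow> acyclic_from (link X (V i)) (length ns)"
    and "\<And>i. i \<in> set ns \<Longrightarrow> V i \<notin> X"
  shows "\<not> coloured_vertices.filler V (fs @ ns) X \<phi>"
  using assms(1,3-)
proof (induction fs arbitrary: \<phi>)
  case Nil
  then show ?case
  proof (induction ns arbitrary: \<phi>)
    case Nil
    show ?case
      by (simp add: not_filler_Nil)
  next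
    case (Cons i ns)
    show ?case
    proof
      assume "coloured_vertices.filler V ([] @ i # ns) X \<phi>"
      then have filler: "coloured_vertices.filler V (i # ns) X \<phi>" and coloured: "coloured_vertices V (i # ns)"
        using Cons.prems(1) by simp_all
      have i: "2 \<le> card (V i)" "V i \<notin> X"
        using Cons.prems(2,4) by simp_all
      have "\<exists>\<psi>. coloured_vertices.filler V ([] @ ns) X \<psi>"
        unfolding append_Nil by (rule filler_tail[OF coloured filler], erule (1) down, use i in simp_all)
      moreover have "\<not> coloured_vertices.filler V ([] @ ns) X \<psi>" for \<psi>
        by (rule Cons.IH) (use Cons.prems coloured_vertices_tail[OF coloured] in simp_all)
      ultimately show False
        by blast
    qed
  qed
next
  case (Cons i fs)
  show ?case
  proof
    assume "coloured_vertices.filler V ((i # fs) @ ns) X \<phi>"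
    then have filler: "coloured_vertices.filler V (i # fs @ ns) X \<phi>" and coloured: "coloured_vertices V (i # fs @ ns)"
      using Cons.prems(1) by simp_all
    have i: "2 \<le> card (V i)" "acyclic_from (link X (V i)) (length (fs @ ns))"
      using Cons.prems(2) acyclic_from_mono[OF Cons.prems(3)[of i]] by simp_all
    have "\<exists>\<psi>. coloured_vertices.filler V (fs @ ns) X \<psi>"
      by (rule filler_tail[OF coloured filler], erule (1) down, use i in simp_all)
    moreover have "\<not> coloured_vertices.filler V (fs @ ns) X \<psi>" for \<psi>
      by (rule Cons.IH) (use Cons.prems coloured_vertices_tail[OF coloured] in simp_all)
    ultimately show False
      by blast
  qed
qed

text \<open>Classes that are not faces contribute \<open>-1\<close> each and all others are
  nonnegative, so already a single Leray number stays below the number of the former.\<close>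

lemma Leray_number_link_less:
  assumes "finite I" "(\<Sum>i\<in>I. link_Leray_dimension X (V i)) < 0" "i \<in> I" "V i \<in> X"
  shows "Leray_number (link X (V i)) < card {i \<in> I. V i \<notin> X}"
proof -
  let ?K = "{i \<in> I. V i \<in> X}" and ?N = "{i \<in> I. V i \<notin> X}"
  have "(\<Sum>i\<in>I. link_Leray_dimension X (V i)) = (\<Sum>i\<in>?K. link_Leray_dimension X (V i)) + (\<Sum>i\<in>?N. link_Leray_dimension X (V i))"
    using assms(1) by (subst sum.union_disjoint[symmetric]) (auto intro!: sum.cong)
  also have "\<dots> = int (\<Sum>i\<in>?K. Leray_number (link X (V i))) - int (card ?N)"
    by (simp add: link_Leray_dimension_def)
  finally have "(\<Sum>i\<in>?K. Leray_number (link X (V i))) < card ?N"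
    using assms(2) by linarith
  moreover have "Leray_number (link X (V i)) \<le> (\<Sum>i\<in>?K. Leray_number (link X (V i)))"
    using assms by (intro member_le_sum) auto
  ultimately show ?thesis
    by simp
qed

text \<open>If some class \<open>V j\<close> has at most one vertex, transversals of the large
  classes remain faces after adding \<open>V j\<close>. They thus lie in its link, whose acyclicity
  takes the place of that of \<open>X\<close>. For empty \<open>V j\<close> the link is
  \<open>X\<close> itself.\<close>

lemma exists_filler:
  assumes coloured: "coloured_vertices V is" and "set is = {i \<in> I. 2 \<le> card (V i)}"
    and down: "\<And>\<sigma> \<tau>. \<sigma> \<in> X \<Longrightarrow> \<tau> \<subseteq> \<sigma> \<Longrightarrow> \<tau> \<in> X"
    and finV: "\<And>i. i \<in> I \<Longrightarrow> finite (V i)"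
    and disjV: "disjoint_family_on V I"
    and transversal: "\<And>\<sigma>. \<sigma> \<subseteq> (\<Union>i\<in>I. V i) \<Longrightarrow> (\<forall>i\<in>I. card (\<sigma> \<inter> V i) \<le> 1) \<Longrightarrow> \<sigma> \<in> X"
    and X: "set is = I \<Longrightarrow> acyclic_from X (length is)"
    and links: "\<And>i. i \<in> I \<Longrightarrow> V i \<in> X \<Longrightarrow> acyclic_from (link X (V i)) (length is)"
  shows "\<exists>\<phi>. coloured_vertices.filler V is X \<phi>"
proof (cases "set is = I")
  case True
  show ?thesis
    by (rule coloured_vertices.filler_exists[OF coloured X[OF True]])
      (auto simp: coloured_vertices.multicoloured_def[OF coloured] True intro!: transversal)
next
  case False
  then obtain j where j: "j \<in> I" "j \<notin> set is"
    using assms(2) by blast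
  then have small: "card (\<tau> \<inter> V j) \<le> 1" for \<tau>
    using card_mono[of "V j" "\<tau> \<inter> V j"] finV[of j] assms(2) by auto
  have disj: "V i \<inter> V j = {}" if "i \<in> I" "i \<noteq> j" for i
    using disjV that j(1) by (auto simp: disjoint_family_on_def)
  have "V j \<in> X"
  proof (rule transversal)
    show "\<forall>i\<in>I. card (V j \<inter> V i) \<le> 1"
    proof
      fix i assume "i \<in> I"
      then show "card (V j \<inter> V i) \<le> 1"
        using small[of "V j"] disj[of i] by (cases "i = j") (auto simp: Int_commute)
    qed
  qed (use j in blast)
  have "\<exists>\<phi>. coloured_vertices.filler V is (link X (V j)) \<phi>"
  proof (rule coloured_vertices.filler_exists[OF coloured links[OF j(1) \<open>V j \<in> X\<close>]])
    fix \<sigma> assume "coloured_vertices.multicoloured V is 1 \<sigma>"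
    then have \<sigma>: "\<sigma> \<subseteq> (\<Union>i\<in>set is. V i)" "\<And>i. i \<in> set is \<Longrightarrow> card (\<sigma> \<inter> V i) = 1"
      by (auto simp: coloured_vertices.multicoloured_def[OF coloured])
    have "\<sigma> \<union> V j \<in> X"
    proof (rule transversal)
      show "\<sigma> \<union> V j \<subseteq> (\<Union>i\<in>I. V i)"
        using \<sigma>(1) assms(2) j by auto
      show "\<forall>i\<in>I. card ((\<sigma> \<union> V j) \<inter> V i) \<le> 1"
      proof
        fix i assume i: "i \<in> I"
        show "card ((\<sigma> \<union> V j) \<inter> V i) \<le> 1"
        proof (cases "i \<in> set is")
          case True
          then have "(\<sigma> \<union> V j) \<inter> V i = \<sigma> \<inter> V i"
            using disj[OF i] j(2) by auto
          then show ?thesis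
            using \<sigma>(2)[OF True] by simp
        next
          case False
          have "card ((\<sigma> \<union> V j) \<inter> V i) \<le> card (V i)"
            by (rule card_mono[OF finV[OF i]]) auto
          then show ?thesis
            using False i assms(2) by simp
        qed
      qed
    qed
    moreover have "\<sigma> \<inter> V j = {}"
    proof -
      have "V i \<inter> V j = {}" if "i \<in> set is" for i
        using that j assms(2) by (intro disj) auto
      then show ?thesis
        using \<sigma>(1) by blast
    qed
    ultimately show "\<sigma> \<in> link X (V j)"
      using down[of "\<sigma> \<union> V j" \<sigma>] by (simp add: link_def)
  qed
  moreover have "link X (V j) \<subseteq> X"
    by (auto simp: link_def)
  ultimately show ?thesis
    using coloured_vertices.filler_mono[OF coloured] by blast
qed

theorem corollary2p5:
  fixes X :: "'a set set" and V :: "nat \<Rightarrow> 'a set" and d r :: nat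
  assumes "r \<ge> d + 1"
    and "simplicial_complex X"
    and "Leray d X"
    and "disjoint_family_on V {1..r}"
    and "vertices X = (\<Union>i\<in>{1..r}. V i)"
    and "\<And>\<sigma>. \<sigma> \<subseteq> (\<Union>i\<in>{1..r}. V i) \<Longrightarrow> (\<forall>i\<in>{1..r}. card (\<sigma> \<inter> V i) \<le> 1) \<Longrightarrow> \<sigma> \<in> X"
  shows "(\<Sum>i=1..r. link_Leray_dimension X (V i)) \<ge> 0"
proof (rule ccontr)
  let ?S = "{i \<in> {1..r}. 2 \<le> card (V i)}" and ?N = "{i \<in> {1..r}. V i \<notin> X}"
  assume "\<not> (\<Sum>i=1..r. link_Leray_dimension X (V i)) \<ge> 0"
  then have neg: "(\<Sum>i\<in>{1..r}. link_Leray_dimension X (V i)) < 0"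
    by simp
  have down: "\<tau> \<in> X" if "\<sigma> \<in> X" "\<tau> \<subseteq> \<sigma>" for \<sigma> \<tau>
    using assms(2) that unfolding simplicial_complex_def by blast
  have finV: "finite (V i)" if "i \<in> {1..r}" for i
  proof (rule finite_subset)
    show "V i \<subseteq> vertices X"
      using assms(5) that by blast
    show "finite (vertices X)"
      using assms(2) unfolding vertices_def simplicial_complex_def by blast
  qed
  \<comment> \<open>A class with at most one vertex is a partial transversal, hence a face.\<close>
  have NS: "?N \<subseteq> ?S"
  proof
    fix j assume j: "j \<in> ?N"
    have "2 \<le> card (V j)"
    proof (rule ccontr)
      assume "\<not> 2 \<le> card (V j)"
      then have "card (V j \<inter> V i) \<le> 1" if "i \<in> {1..r}" for i
        using card_mono[OF finV, of j "V j \<inter> V i"] j by simp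
      then show False
        using assms(6)[of "V j"] j by blast
    qed
    then show "j \<in> ?S"
      using j by simp
  qed
  \<comment> \<open>The strict inequality absorbs the shift between dimension and number of
    vertices.\<close>
  have links: "acyclic_from (link X (V i)) m" if "i \<in> {1..r}" "V i \<in> X" "card ?N \<le> m" for i m
  proof (rule acyclic_from_mono[OF acyclic_from_Leray[OF simplicial_complex_link[OF assms(2) that(2)]]])
    show "Leray_number (link X (V i)) + 1 \<le> m"
      using Leray_number_link_less[OF _ neg that(1,2)] that(3) by simp
  qed
  \<comment> \<open>The large classes that are faces come first, in the order in which
    \<open>not_filler\<close> removes them.\<close>
  obtain fs ns where fs: "set fs = ?S - ?N" "distinct fs" and ns: "set ns = ?N" "distinct ns"
    using finite_distinct_list[of "?S - ?N"] finite_distinct_list[of ?N] by auto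
  have set_is: "set (fs @ ns) = ?S"
    using NS by (auto simp: fs(1) ns(1))
  have len: "card ?N = length ns"
    using distinct_card[OF ns(2)] ns(1) by simp
  have coloured: "coloured_vertices V (fs @ ns)"
  proof (rule coloured_vertices.intro)
    show "distinct (fs @ ns)"
      using fs ns by auto
    show "disjoint_family_on V (set (fs @ ns))"
      unfolding set_is by (rule disjoint_family_on_mono[OF _ assms(4)]) auto
    show "finite (V i)" if "i \<in> set (fs @ ns)" for i
      using that finV unfolding set_is by simp
  qed
  have "\<exists>\<phi>. coloured_vertices.filler V (fs @ ns) X \<phi>"
  proof (rule exists_filler[OF coloured set_is _ _ assms(4)])
    \<comment> \<open>Here no class is small, so all \<open>r\<close> colours are listed and
      \<open>r \<ge> d + 1\<close> gives the required range.\<close>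
    show "acyclic_from X (length (fs @ ns))" if "set (fs @ ns) = {1..r}"
    proof (rule acyclic_from_mono[OF acyclic_from_Leray[OF assms(2)]])
      have "length (fs @ ns) = r"
        using distinct_card[OF coloured_vertices.distinct[OF coloured]] that by simp
      then show "Leray_number X + 1 \<le> length (fs @ ns)"
        using assms(1,3) by (simp add: Leray_def)
    qed
    show "acyclic_from (link X (V i)) (length (fs @ ns))" if "i \<in> {1..r}" "V i \<in> X" for i
      by (rule links[OF that]) (use len in simp)
  qed (use down finV assms(6) in blast)+
  moreover have "\<not> coloured_vertices.filler V (fs @ ns) X \<phi>" for \<phi>
  proof (rule not_filler[OF coloured down])
    show "2 \<le> card (V i)" if "i \<in> set (fs @ ns)" for i
      using that unfolding set_is by simp
    show "acyclic_from (link X (V i)) (length ns)" if "i \<in> set fs" for i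
      by (rule links) (use that fs(1) len in auto)
    show "V i \<notin> X" if "i \<in> set ns" for i
      using that ns(1) by simp
  qed
  ultimately show False
    by blast
qed

end
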